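(* Let $M^n$ be a connected hypersurface immersed in the unit sphere $\mathbb{S}^{n+1}$ with shape operator $A$, mean curvature $H=\mathrm{Tr}(A)/n$ and squared length of the second fundamental form $S=\|A\|^2$. For $a\in\mathbb{S}^{n+1}$ let $\varphi_a=\langle x,a\rangle$ and $\psi_a=\langle \nu,a\rangle$ be the position and normal height functions on $M^n$. (i) $H$ is constant if and only if there exist some continuous function $\lambda$ on $M^n$ and some constant $\mu$ such that for all $a\in\mathbb{S}^{n+1}$, $$\Delta\varphi_a=-\lambda\varphi_a+n\mu\psi_a,$$ in which case $\lambda=n$ and $\mu=H$. In particular, $H=0$ if and only if there exists a continuous function $\lambda$ on $M^n$ such that $\Delta\varphi_a=-\lambda\varphi_a$ for all $a\in\mathbb{S}^{n+1}$. (ii) $H$ is constant if and only if there exist some continuous functions $\lambda$ and $\mu$ on $M^n$ such that for all $a\in\mathbb{S}^{n+1}$, $$\Delta\psi_a=-\lambda\psi_a+n\mu\varphi_a,$$ in which case $\lambda=S$ and $\mu=H$. In particular, $H=0$ if and only if there exists a continuous function $\lambda$ on $M^n$ such that $\Delta\psi_a=-\lambda\psi_a$ for all $a\in\mathbb{S}^{n+1}$. (iii) $H$ and $S$ are both constant if and only if there exist some constant $\lambda$ and some continuous function $\mu$ on $M^n$ such that for all $a\in\mathbb{S}^{n+1}$, $$\Delta\psi_a=-\lambda\psi_a+n\mu\varphi_a,$$ in which case $\lambda=S$ and $\mu=H$. In particular, $H=0$ and $S$ is constant if and only if there exists a constant $\lambda$ such that $\Delta\psi_a=-\lambda\psi_a$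 for all $a\in\mathbb{S}^{n+1}$.
   Context: $x:M^n\to\mathbb{S}^{n+1}\subset\mathbb{R}^{n+2}$ denotes the (smooth) immersion, $\nu$ the unit normal vector field of $M^n$ in $\mathbb{S}^{n+1}$ (regarded as an $\mathbb{R}^{n+2}$-valued function along $M^n$), and $\langle\cdot,\cdot\rangle$ the Euclidean inner product of $\mathbb{R}^{n+2}$. The shape operator is $A(X)=-\widetilde\nabla_X\nu$, where $\widetilde\nabla$ is the Levi-Civita connection of $\mathbb{S}^{n+1}$. $\Delta$ is the Laplace–Beltrami operator of the induced metric, with sign convention $\Delta f=\mathrm{Tr}(\mathrm{Hess} f)$. The functions/constants $\lambda,\mu$ are independent of $a$. *)

theory Defs
  imports "HOL-Analysis.Analysis"
begin

section \<open>Smooth manifolds\<close>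

text \<open>\<open>Ck_on k S f\<close>: all iterated directional derivatives of \<open>f\<close> of order at most \<open>k\<close> exist and
  are continuous on the open set \<open>S\<close> (for non-open \<open>S\<close> the notion is not meant to be used).\<close>

primrec Ck_on :: "nat \<Rightarrow> 'a::euclidean_space set \<Rightarrow> ('a \<Rightarrow> 'b::euclidean_space) \<Rightarrow> bool" where
  "Ck_on 0 S f \<longleftrightarrow> continuous_on S f"
| "Ck_on (Suc k) S f \<longleftrightarrow>
     (\<forall>u\<in>S. f differentiable (at u)) \<and> (\<forall>v. Ck_on k S (\<lambda>u. frechet_derivative f (at u) v))"

definition smooth_on :: "'a::euclidean_space set \<Rightarrow> ('a \<Rightarrow> 'b::euclidean_space) \<Rightarrow> bool" where
  "smooth_on S f \<longleftrightarrow> (\<forall>k. Ck_on k S f)"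

text \<open>A chart is a pair (domain, coordinate map).\<close>

type_synonym ('m, 'n) chart = "'m set \<times> ('m \<Rightarrow> real ^ 'n)"

definition chart_dom :: "('m, 'n) chart \<Rightarrow> 'm set" where
  "chart_dom c = fst c"

definition coord :: "('m, 'n) chart \<Rightarrow> 'm \<Rightarrow> real ^ 'n" where
  "coord c = snd c"

definition chart_codom :: "('m, 'n) chart \<Rightarrow> (real ^ 'n) set" where
  "chart_codom c = coord c ` chart_dom c"

text \<open>The expression of a map \<open>f\<close> on the manifold in the coordinates of \<open>c\<close>, meaningful on \<open>chart_codom c\<close>.\<close>

definition local_expr :: "('m, 'n) chart \<Rightarrow> ('m \<Rightarrow> 'b) \<Rightarrow> real ^ 'n \<Rightarrow> 'b" where
  "local_expr c f = f \<circ> inv_into (chart_dom c) (coord c)"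

definition is_chart :: "'m topology \<Rightarrow> ('m, 'n::finite) chart \<Rightarrow> bool" where
  "is_chart T c \<longleftrightarrow> openin T (chart_dom c) \<and> open (chart_codom c) \<and>
     homeomorphic_map (subtopology T (chart_dom c)) (top_of_set (chart_codom c)) (coord c)"

text \<open>The atlas need not be maximal; it determines the smooth structure.  Smoothness of all transition
  maps in both directions is covered by letting the pair range over all ordered pairs of charts.\<close>

definition smooth_manifold :: "'m topology \<Rightarrow> ('m, 'n::finite) chart set \<Rightarrow> bool" where
  "smooth_manifold T \<A> \<longleftrightarrow>
     Hausdorff_space T \<and> second_countable T \<and>
     (\<forall>c\<in>\<A>. is_chart T c) \<and> \<Union> (chart_dom ` \<A>) = topspace T \<and>
     (\<forall>c\<in>\<A>. \<forall>d\<in>\<A>. smooth_on (coord c ` (chart_dom c \<inter> chart_dom d)) (local_expr c (coord d)))"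

definition smooth_map :: "('m, 'n::finite) chart set \<Rightarrow> ('m \<Rightarrow> 'b::euclidean_space) \<Rightarrow> bool" where
  "smooth_map \<A> f \<longleftrightarrow> (\<forall>c\<in>\<A>. smooth_on (chart_codom c) (local_expr c f))"

text \<open>The differential at \<open>p\<close>, where a tangent vector at \<open>p\<close> is represented by its components
  in the coordinate basis of the chart \<open>c\<close>.\<close>

definition differential :: "('m, 'n::finite) chart \<Rightarrow> ('m \<Rightarrow> 'b::euclidean_space) \<Rightarrow> 'm \<Rightarrow> real ^ 'n \<Rightarrow> 'b" where
  "differential c f p = frechet_derivative (local_expr c f) (at (coord c p))"

section \<open>Immersed hypersurfaces of the unit sphere\<close>

text \<open>Smoothness as a map into the sphere is the same as smoothness as a map into the ambient
  Euclidean space with values in the sphere, the sphere being an embedded submanifold.\<close>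

definition immersion_into_sphere ::
    "('m, 'n::finite) chart set \<Rightarrow> ('m \<Rightarrow> 'e::euclidean_space) \<Rightarrow> bool" where
  "immersion_into_sphere \<A> x \<longleftrightarrow>
     smooth_map \<A> x \<and>
     (\<forall>c\<in>\<A>. \<forall>p\<in>chart_dom c. x p \<in> sphere 0 1 \<and> inj (differential c x p))"

definition unit_normal_field ::
    "('m, 'n::finite) chart set \<Rightarrow> ('m \<Rightarrow> 'e::euclidean_space) \<Rightarrow> ('m \<Rightarrow> 'e) \<Rightarrow> bool" where
  "unit_normal_field \<A> x \<nu> \<longleftrightarrow>
     smooth_map \<A> \<nu> \<and>
     (\<forall>c\<in>\<A>. \<forall>p\<in>chart_dom c. norm (\<nu> p) = 1 \<and> \<nu> p \<bullet> x p = 0 \<and> (\<forall>v. \<nu> p \<bullet> differential c x p v = 0))"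

text \<open>The pointwise quantities below are computed in a chart around the point.  Those of them that are
  functions on the manifold (mean curvature, squared length of the second fundamental form, Laplacian)
  do not depend on which chart is picked.\<close>

definition chart_at :: "('m, 'n) chart set \<Rightarrow> 'm \<Rightarrow> ('m, 'n) chart" where
  "chart_at \<A> p = (SOME c. c \<in> \<A> \<and> p \<in> chart_dom c)"

subsection \<open>Shape operator\<close>

text \<open>The covariant derivative, for the Levi-Civita connection of the unit sphere, of the vector field
  \<open>V\<close> along \<open>x\<close> (tangent to the sphere) in direction \<open>v\<close>: the flat derivative of the ambient space
  projected orthogonally to the tangent space of the sphere at \<open>x p\<close>.\<close>

definition sphere_connection ::
    "('m, 'n::finite) chart \<Rightarrow> ('m \<Rightarrow> 'e::euclidean_space) \<Rightarrow> ('m \<Rightarrow> 'e) \<Rightarrow> 'm \<Rightarrow> real ^ 'n \<Rightarrow> 'e" where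
  "sphere_connection c x V p v =
     differential c V p v - (differential c V p v \<bullet> x p) *\<^sub>R x p"

definition shape_operator ::
    "('m, 'n::finite) chart \<Rightarrow> ('m \<Rightarrow> 'e::euclidean_space) \<Rightarrow> ('m \<Rightarrow> 'e) \<Rightarrow> 'm \<Rightarrow> real ^ 'n \<Rightarrow> real ^ 'n" where
  "shape_operator c x \<nu> p v =
     (THE w. differential c x p w = - sphere_connection c x \<nu> p v)"

definition mean_curvature ::
    "('m, 'n::finite) chart set \<Rightarrow> ('m \<Rightarrow> 'e::euclidean_space) \<Rightarrow> ('m \<Rightarrow> 'e) \<Rightarrow> 'm \<Rightarrow> real" where
  "mean_curvature \<A> x \<nu> p =
     trace (matrix (shape_operator (chart_at \<A> p) x \<nu> p)) / real CARD('n)"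

subsection \<open>Induced metric\<close>

text \<open>The matrix of the induced metric, as a function on the coordinate domain of \<open>c\<close>.\<close>

definition partial_deriv :: "'n::finite \<Rightarrow> (real ^ 'n \<Rightarrow> 'b::euclidean_space) \<Rightarrow> real ^ 'n \<Rightarrow> 'b" where
  "partial_deriv i F u = frechet_derivative F (at u) (axis i 1)"

definition induced_metric ::
    "('m, 'n::finite) chart \<Rightarrow> ('m \<Rightarrow> 'e::euclidean_space) \<Rightarrow> real ^ 'n \<Rightarrow> real ^ 'n ^ 'n" where
  "induced_metric c x u = (\<chi> i j. partial_deriv i (local_expr c x) u \<bullet> partial_deriv j (local_expr c x) u)"

text \<open>The squared norm of \<open>A\<close> for the induced metric,
  \<open>g\<^sup>i\<^sup>j g(A \<partial>\<^sub>i, A \<partial>\<^sub>j)\<close>, i.e. the trace of the \<open>g\<close>-adjoint of \<open>A\<close> composed with \<open>A\<close>.\<close>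

definition second_ff_sq ::
    "('m, 'n::finite) chart set \<Rightarrow> ('m \<Rightarrow> 'e::euclidean_space) \<Rightarrow> ('m \<Rightarrow> 'e) \<Rightarrow> 'm \<Rightarrow> real" where
  "second_ff_sq \<A> x \<nu> p =
     (let c = chart_at \<A> p; A = shape_operator c x \<nu> p in
      \<Sum>i\<in>UNIV. \<Sum>j\<in>UNIV. matrix_inv (induced_metric c x (coord c p)) $ i $ j *
        (differential c x p (A (axis i 1)) \<bullet> differential c x p (A (axis j 1))))"

subsection \<open>Laplace--Beltrami operator\<close>

text \<open>\<open>christoffel c x k i j\<close> is \<open>\<Gamma>\<^sup>k\<^sub>i\<^sub>j\<close> for the Levi-Civita connection
  of the induced metric.\<close>

definition christoffel ::
    "('m, 'n::finite) chart \<Rightarrow> ('m \<Rightarrow> 'e::euclidean_space) \<Rightarrow> 'n \<Rightarrow> 'n \<Rightarrow> 'n \<Rightarrow> real ^ 'n \<Rightarrow> real" where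
  "christoffel c x k i j u =
     (\<Sum>l\<in>UNIV. matrix_inv (induced_metric c x u) $ k $ l *
        (partial_deriv i (\<lambda>w. induced_metric c x w $ j $ l) u
         + partial_deriv j (\<lambda>w. induced_metric c x w $ i $ l) u
         - partial_deriv l (\<lambda>w. induced_metric c x w $ i $ j) u)) / 2"

text \<open>The components \<open>\<partial>\<^sub>i (\<partial>\<^sub>j f) - (\<nabla>\<^bsub>\<partial>\<^sub>i\<^esub> \<partial>\<^sub>j) f\<close>
  of the Hessian.\<close>

definition hessian ::
    "('m, 'n::finite) chart \<Rightarrow> ('m \<Rightarrow> 'e::euclidean_space) \<Rightarrow> ('m \<Rightarrow> real) \<Rightarrow> real ^ 'n \<Rightarrow> real ^ 'n ^ 'n" where
  "hessian c x f u =
     (\<chi> i j. partial_deriv i (partial_deriv j (local_expr c f)) u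
             - (\<Sum>k\<in>UNIV. christoffel c x k i j u * partial_deriv k (local_expr c f) u))"

text \<open>The trace of the Hessian with respect to the induced metric, i.e. of the endomorphism
  obtained from it by raising an index.\<close>

definition laplacian ::
    "('m, 'n::finite) chart set \<Rightarrow> ('m \<Rightarrow> 'e::euclidean_space) \<Rightarrow> ('m \<Rightarrow> real) \<Rightarrow> 'm \<Rightarrow> real" where
  "laplacian \<A> x f p =
     (let c = chart_at \<A> p; u = coord c p in
      trace (matrix_inv (induced_metric c x u) ** hessian c x f u))"

subsection \<open>Height functions\<close>

text \<open>The position height function is \<open>height x a\<close>, the normal height function \<open>height \<nu> a\<close>.\<close>

definition height :: "('m \<Rightarrow> 'e::euclidean_space) \<Rightarrow> 'e \<Rightarrow> 'm \<Rightarrow> real" where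
  "height y a p = y p \<bullet> a"

end

theory Submission
  imports Defs
begin

text \<open>
  For all \<open>a\<close> at once, the height functions encode the vector-valued Laplacians of \<open>x\<close> and \<open>\<nu>\<close>.
  Pairing these with the frame \<open>x\<close>, \<open>\<nu>\<close>, \<open>\<partial>\<^sub>l x\<close>, which spans the ambient space because the
  codimension is two, gives \<open>\<Delta>x = - n x + n H \<nu>\<close> and \<open>\<Delta>\<nu> = - S \<nu> + n H x - n \<nabla>H\<close>, where the
  tangential part of the second identity is the traced Codazzi equation.  Since \<open>x\<close> and \<open>\<nu>\<close> are
  orthonormal and \<open>\<nabla>H\<close> is tangent, an equation of the stated form determines its coefficients
  pointwise, and for \<open>\<nu>\<close> it holds exactly where the gradient of \<open>H\<close> vanishes.  The shape operators
  computed in two charts are conjugate by the Jacobian of the transition map, so \<open>n H = tr A\<close> and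
  \<open>S = tr A\<^sup>2\<close> are well-defined functions, and a vanishing gradient on a connected manifold makes
  \<open>H\<close> constant.
\<close>

subsection \<open>Partial derivatives of smooth maps\<close>

lemma smooth_on_imp_Ck: "smooth_on S f \<Longrightarrow> Ck_on k S f"
  by (simp add: smooth_on_def)

lemma smooth_on_imp_continuous_on: "smooth_on S f \<Longrightarrow> continuous_on S f"
  using smooth_on_imp_Ck[of S f 0] by simp

lemma smooth_on_imp_differentiable: "smooth_on S f \<Longrightarrow> u \<in> S \<Longrightarrow> f differentiable (at u)"
  using smooth_on_imp_Ck[of S f "Suc 0"] by simp

lemma smooth_on_frechet_derivative:
  "smooth_on S f \<Longrightarrow> smooth_on S (\<lambda>u. frechet_derivative f (at u) v)"
  unfolding smooth_on_def
proof
  fix k assume "\<forall>k. Ck_on k S f"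
  then have "Ck_on (Suc k) S f" by blast
  then show "Ck_on k S (\<lambda>u. frechet_derivative f (at u) v)" by simp
qed

lemma smooth_on_partial_deriv: "smooth_on S f \<Longrightarrow> smooth_on S (partial_deriv i f)"
  unfolding partial_deriv_def[abs_def] by (rule smooth_on_frechet_derivative)

lemma frechet_derivative_has_derivative:
  "f differentiable (at u) \<Longrightarrow> (f has_derivative frechet_derivative f (at u)) (at u)"
  by (simp add: frechet_derivative_works)

lemma frechet_derivative_eqI: "(f has_derivative f') (at u) \<Longrightarrow> frechet_derivative f (at u) = f'"
  using frechet_derivative_at by metis

lemma frechet_derivative_eq_sum_partial_deriv:
  fixes F :: "real ^ 'n::finite \<Rightarrow> 'b::euclidean_space"
  assumes "F differentiable (at u)"
  shows "frechet_derivative F (at u) v = (\<Sum>i\<in>UNIV. v $ i *\<^sub>R partial_deriv i F u)"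
proof -
  interpret linear "frechet_derivative F (at u)"
    using assms by (rule linear_frechet_derivative)
  have "frechet_derivative F (at u) v = frechet_derivative F (at u) (\<Sum>i\<in>UNIV. v $ i *\<^sub>R axis i 1)"
    using basis_expansion[of v] by (simp add: scalar_mult_eq_scaleR)
  then show ?thesis by (simp add: sum scale partial_deriv_def)
qed

lemma partial_deriv_cong:
  assumes "open U" "u \<in> U" "\<And>w. w \<in> U \<Longrightarrow> F w = G w" "F differentiable (at u)"
  shows "partial_deriv i F u = partial_deriv i G u"
  unfolding partial_deriv_def
  using frechet_derivative_transform_within_open[of F u U G] assms by metis

lemma partial_deriv_inner:
  fixes F G :: "real ^ 'n::finite \<Rightarrow> 'b::euclidean_space"
  assumes "F differentiable (at u)" "G differentiable (at u)"
  shows "partial_deriv i (\<lambda>w. F w \<bullet> G w) u = partial_deriv i F u \<bullet> G u + F u \<bullet> partial_deriv i G u"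
  unfolding partial_deriv_def
    frechet_derivative_eqI[OF has_derivative_inner[OF assms[THEN frechet_derivative_has_derivative]]]
  by simp

lemma partial_deriv_inner_const:
  fixes F :: "real ^ 'n::finite \<Rightarrow> 'b::euclidean_space"
  assumes "F differentiable (at u)"
  shows "partial_deriv i (\<lambda>w. F w \<bullet> a) u = partial_deriv i F u \<bullet> a"
  using partial_deriv_inner[OF assms differentiable_const, of i a] by (simp add: partial_deriv_def)

lemma partial_deriv_scaleR:
  fixes F :: "real ^ 'n::finite \<Rightarrow> 'b::euclidean_space"
  assumes "f differentiable (at u)" "F differentiable (at u)"
  shows "partial_deriv i (\<lambda>w. f w *\<^sub>R F w) u = partial_deriv i f u *\<^sub>R F u + f u *\<^sub>R partial_deriv i F u"
  unfolding partial_deriv_def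
    frechet_derivative_eqI[OF has_derivative_scaleR[OF assms[THEN frechet_derivative_has_derivative]]]
  by simp

lemma partial_deriv_sum:
  fixes F :: "'i \<Rightarrow> real ^ 'n::finite \<Rightarrow> 'b::euclidean_space"
  assumes "\<And>k. k \<in> K \<Longrightarrow> F k differentiable (at u)"
  shows "partial_deriv i (\<lambda>w. \<Sum>k\<in>K. F k w) u = (\<Sum>k\<in>K. partial_deriv i (F k) u)"
proof -
  have "((\<lambda>w. \<Sum>k\<in>K. F k w) has_derivative (\<lambda>h. \<Sum>k\<in>K. frechet_derivative (F k) (at u) h)) (at u)"
    by (intro has_derivative_sum frechet_derivative_has_derivative assms)
  from frechet_derivative_eqI[OF this] show ?thesis by (simp add: partial_deriv_def)
qed

lemma partial_deriv_minus:
  fixes F :: "real ^ 'n::finite \<Rightarrow> 'b::euclidean_space"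
  assumes "F differentiable (at u)"
  shows "partial_deriv i (\<lambda>w. - F w) u = - partial_deriv i F u"
  unfolding partial_deriv_def
    frechet_derivative_eqI[OF has_derivative_minus[OF assms[THEN frechet_derivative_has_derivative]]]
  by simp

lemma partial_deriv_inner_eq:
  assumes "smooth_on U F" "smooth_on U G" "open U" "u \<in> U" "\<And>w. w \<in> U \<Longrightarrow> F w \<bullet> G w = h w"
  shows "partial_deriv i F u \<bullet> G u + F u \<bullet> partial_deriv i G u = partial_deriv i h u"
proof -
  have "partial_deriv i (\<lambda>w. F w \<bullet> G w) u = partial_deriv i h u"
    using assms smooth_on_imp_differentiable
    by (intro partial_deriv_cong[of U]) (auto intro!: differentiable_inner)
  then show ?thesis
    using assms by (simp add: partial_deriv_inner smooth_on_imp_differentiable)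
qed

text \<open>Product rule for a constant inner product. Together with the defining conditions on
  \<open>x\<close> and \<open>\<nu>\<close> it is the source of the first- and second-order
  relations of the moving frame.\<close>

lemma partial_deriv_inner_const_zero:
  assumes "smooth_on U F" "smooth_on U G" "open U" "u \<in> U" "\<And>w. w \<in> U \<Longrightarrow> F w \<bullet> G w = (k::real)"
  shows "partial_deriv i F u \<bullet> G u + F u \<bullet> partial_deriv i G u = 0"
  using partial_deriv_inner_eq[OF assms(1-4), of "\<lambda>_. k"] assms(5) by (simp add: partial_deriv_def)

subsection \<open>Symmetry of mixed derivatives\<close>

text \<open>Two applications of the mean value theorem to the second difference over a parallelogram
  with sides along \<open>v\<close> and \<open>w\<close>: first in \<open>s\<close>, to the
  difference of two opposite edges, then in \<open>t\<close>, to the derivative along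
  \<open>v\<close>.\<close>

lemma double_mean_value:
  fixes f :: "'a::euclidean_space \<Rightarrow> real"
  assumes smooth: "smooth_on U f" and h: "0 < h"
    and U: "\<And>s t. 0 \<le> s \<Longrightarrow> s \<le> h \<Longrightarrow> 0 \<le> t \<Longrightarrow> t \<le> h \<Longrightarrow> u + s *\<^sub>R v + t *\<^sub>R w \<in> U"
  shows "\<exists>s t. 0 < s \<and> s < h \<and> 0 < t \<and> t < h \<and>
    f (u + h *\<^sub>R v + h *\<^sub>R w) - f (u + h *\<^sub>R v) - f (u + h *\<^sub>R w) + f u =
    h * h * frechet_derivative (\<lambda>z. frechet_derivative f (at z) v) (at (u + s *\<^sub>R v + t *\<^sub>R w)) w"
proof -
  \<comment> \<open>Homogeneity turns the Frechet derivative along a line into a real derivative,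
    the form that \<open>MVT2\<close> takes.\<close>
  have lin: "c * frechet_derivative f (at z) a = frechet_derivative f (at z) (c *\<^sub>R a)"
    if "smooth_on U f" "z \<in> U" for f :: "'a \<Rightarrow> real" and c z a
    using linear_frechet_derivative[OF smooth_on_imp_differentiable[OF that]]
    by (simp add: linear_scale)
  have dv: "((\<lambda>s. f (u + s *\<^sub>R v + t *\<^sub>R w)) has_real_derivative
      frechet_derivative f (at (u + s *\<^sub>R v + t *\<^sub>R w)) v) (at s)"
    if "0 \<le> s" "s \<le> h" "0 \<le> t" "t \<le> h" for s t
  proof -
    have "((\<lambda>s. u + s *\<^sub>R v + t *\<^sub>R w) has_derivative (\<lambda>r. r *\<^sub>R v)) (at s)"
      by (auto intro!: derivative_eq_intros)
    from diff_chain_at[OF this frechet_derivative_has_derivative[OF smooth_on_imp_differentiable[OF smooth]]] U[OF that]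
    have "((\<lambda>s. f (u + s *\<^sub>R v + t *\<^sub>R w)) has_derivative
        (\<lambda>r. frechet_derivative f (at (u + s *\<^sub>R v + t *\<^sub>R w)) (r *\<^sub>R v))) (at s)"
      by (simp add: o_def)
    then show ?thesis
      by (simp add: has_field_derivative_def lin[OF smooth U[OF that], symmetric] mult_commute_abs)
  qed
  let ?g = "\<lambda>z. frechet_derivative f (at z) v"
  have sg: "smooth_on U ?g" using smooth by (rule smooth_on_frechet_derivative)
  have dw: "((\<lambda>t. ?g (u + s *\<^sub>R v + t *\<^sub>R w)) has_real_derivative
      frechet_derivative ?g (at (u + s *\<^sub>R v + t *\<^sub>R w)) w) (at t)"
    if "0 \<le> s" "s \<le> h" "0 \<le> t" "t \<le> h" for s t
  proof -
    have "((\<lambda>t. u + s *\<^sub>R v + t *\<^sub>R w) has_derivative (\<lambda>r. r *\<^sub>R w)) (at t)"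
      by (auto intro!: derivative_eq_intros)
    from diff_chain_at[OF this frechet_derivative_has_derivative[OF smooth_on_imp_differentiable[OF sg]]] U[OF that]
    have "((\<lambda>t. ?g (u + s *\<^sub>R v + t *\<^sub>R w)) has_derivative
        (\<lambda>r. frechet_derivative ?g (at (u + s *\<^sub>R v + t *\<^sub>R w)) (r *\<^sub>R w))) (at t)"
      by (simp add: o_def)
    then show ?thesis
      by (simp add: has_field_derivative_def lin[OF sg U[OF that], symmetric] mult_commute_abs)
  qed
  have d1: "((\<lambda>s. f (u + s *\<^sub>R v + h *\<^sub>R w) - f (u + s *\<^sub>R v)) has_real_derivative
      ?g (u + s *\<^sub>R v + h *\<^sub>R w) - ?g (u + s *\<^sub>R v)) (at s)" if "0 \<le> s" "s \<le> h" for s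
    using DERIV_diff[OF dv[OF that, of h] dv[OF that, of 0]] h by simp
  obtain s where s: "0 < s" "s < h"
    "(f (u + h *\<^sub>R v + h *\<^sub>R w) - f (u + h *\<^sub>R v)) - (f (u + 0 *\<^sub>R v + h *\<^sub>R w) - f (u + 0 *\<^sub>R v))
     = (h - 0) * (?g (u + s *\<^sub>R v + h *\<^sub>R w) - ?g (u + s *\<^sub>R v))"
    using MVT2[OF h d1] by blast
  have d2: "((\<lambda>t. ?g (u + s *\<^sub>R v + t *\<^sub>R w)) has_real_derivative
      frechet_derivative ?g (at (u + s *\<^sub>R v + t *\<^sub>R w)) w) (at t)" if "0 \<le> t" "t \<le> h" for t
    using dw[of s t] s that by simp
  obtain t where t: "0 < t" "t < h"
    "?g (u + s *\<^sub>R v + h *\<^sub>R w) - ?g (u + s *\<^sub>R v + 0 *\<^sub>R w)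
     = (h - 0) * frechet_derivative ?g (at (u + s *\<^sub>R v + t *\<^sub>R w)) w"
    using MVT2[OF h d2] by blast
  show ?thesis
    using s t by (intro exI[of _ s] exI[of _ t]) (simp add: algebra_simps)
qed

text \<open>The second difference is symmetric in \<open>v\<close> and \<open>w\<close>, and
  \<open>double_mean_value\<close> expresses it through either mixed derivative at a point near
  \<open>u\<close>. If the two differed at \<open>u\<close>, continuity would keep them apart on a
  small parallelogram.\<close>

lemma mixed_derivatives_commute_real:
  fixes f :: "'a::euclidean_space \<Rightarrow> real"
  assumes smooth: "smooth_on U f" and U: "open U" "u \<in> U"
  shows "frechet_derivative (\<lambda>z. frechet_derivative f (at z) v) (at u) w
       = frechet_derivative (\<lambda>z. frechet_derivative f (at z) w) (at u) v"
proof (rule ccontr)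
  let ?P = "\<lambda>z. frechet_derivative (\<lambda>z. frechet_derivative f (at z) v) (at z) w"
  let ?Q = "\<lambda>z. frechet_derivative (\<lambda>z. frechet_derivative f (at z) w) (at z) v"
  assume ne: "?P u \<noteq> ?Q u"
  \<comment> \<open>Half the gap, so that two errors below \<open>e\<close> cannot bridge
    it.\<close>
  define e where "e = \<bar>?P u - ?Q u\<bar> / 2"
  have e: "0 < e" using ne by (simp add: e_def)
  have "continuous_on U ?P" "continuous_on U ?Q"
    by (intro smooth_on_imp_continuous_on smooth_on_frechet_derivative smooth)+
  moreover have "\<forall>\<^sub>F z in nhds u. dist (q z) (q u) < e" if "continuous_on U q" for q :: "'a \<Rightarrow> real"
  proof -
    have "isCont q u" using that U by (simp add: continuous_on_eq_continuous_at)
    then have "(q \<longlongrightarrow> q u) (nhds u)" unfolding isCont_def tendsto_at_iff_tendsto_nhds .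
    then show ?thesis using e by (rule tendstoD)
  qed
  ultimately have "\<forall>\<^sub>F z in nhds u. dist (?P z) (?P u) < e" "\<forall>\<^sub>F z in nhds u. dist (?Q z) (?Q u) < e"
    by blast+
  moreover have "\<forall>\<^sub>F z in nhds u. z \<in> U" using U by (simp add: eventually_nhds_in_open)
  ultimately have "\<forall>\<^sub>F z in nhds u. dist (?P z) (?P u) < e \<and> dist (?Q z) (?Q u) < e \<and> z \<in> U"
    by eventually_elim simp
  then obtain d where d: "0 < d"
    "\<And>z. dist z u < d \<Longrightarrow> dist (?P z) (?P u) < e \<and> dist (?Q z) (?Q u) < e \<and> z \<in> U"
    by (auto simp: eventually_nhds_metric)
  \<comment> \<open>The summand \<open>1\<close> keeps the denominator positive when
    \<open>v\<close> and \<open>w\<close> both vanish and makes the bound in \<open>near\<close>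
    strict.\<close>
  define h where "h = d / (norm v + norm w + 1)"
  have pos: "0 < norm v + norm w + 1" by (simp add: add_nonneg_pos)
  have h: "0 < h" using d(1) pos by (simp add: h_def)
  have near: "dist (u + s *\<^sub>R v + t *\<^sub>R w) u < d" if "0 \<le> s" "s \<le> h" "0 \<le> t" "t \<le> h" for s t
  proof -
    have "dist (u + s *\<^sub>R v + t *\<^sub>R w) u = norm (s *\<^sub>R v + t *\<^sub>R w)"
      by (simp add: dist_norm algebra_simps)
    also have "\<dots> \<le> s * norm v + t * norm w"
      using norm_triangle_ineq[of "s *\<^sub>R v" "t *\<^sub>R w"] that by simp
    also have "\<dots> \<le> h * norm v + h * norm w" using that by (intro add_mono mult_right_mono) auto
    also have "\<dots> < h * (norm v + norm w + 1)" using h by (simp add: algebra_simps)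
    also have "\<dots> = d" using pos by (simp add: h_def)
    finally show ?thesis .
  qed
  obtain s t where st: "0 < s" "s < h" "0 < t" "t < h"
    "f (u + h *\<^sub>R v + h *\<^sub>R w) - f (u + h *\<^sub>R v) - f (u + h *\<^sub>R w) + f u = h * h * ?P (u + s *\<^sub>R v + t *\<^sub>R w)"
    using double_mean_value[OF smooth h, of u v w] near d(2) by blast
  have near': "dist (u + s *\<^sub>R w + t *\<^sub>R v) u < d" if "0 \<le> s" "s \<le> h" "0 \<le> t" "t \<le> h" for s t
    using near[of t s] that by (simp add: add.commute add.left_commute)
  obtain s' t' where st': "0 < s'" "s' < h" "0 < t'" "t' < h"
    "f (u + h *\<^sub>R w + h *\<^sub>R v) - f (u + h *\<^sub>R w) - f (u + h *\<^sub>R v) + f u = h * h * ?Q (u + s' *\<^sub>R w + t' *\<^sub>R v)"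
    using double_mean_value[OF smooth h, of u w v] near' d(2) by blast
  have "h * h * ?P (u + s *\<^sub>R v + t *\<^sub>R w) = h * h * ?Q (u + s' *\<^sub>R w + t' *\<^sub>R v)"
    unfolding st(5)[symmetric] st'(5)[symmetric] by (simp add: ac_simps)
  then have "?P (u + s *\<^sub>R v + t *\<^sub>R w) = ?Q (u + s' *\<^sub>R w + t' *\<^sub>R v)" using h by simp
  moreover have "dist (?P (u + s *\<^sub>R v + t *\<^sub>R w)) (?P u) < e"
    using d(2) near[of s t] st by simp
  moreover have "dist (?Q (u + s' *\<^sub>R w + t' *\<^sub>R v)) (?Q u) < e"
    using d(2) near'[of s' t'] st' by simp
  ultimately have "\<bar>?P u - ?Q u\<bar> < 2 * e" by (simp add: dist_real_def)
  then show False by (simp add: e_def)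
qed

text \<open>On an open set, derivatives depend only on the values there; the induction passes this
  through all orders, with both functions replaced by their derivatives at each step.\<close>

lemma Ck_on_cong:
  assumes "open U" "\<And>w. w \<in> U \<Longrightarrow> f w = g w" "Ck_on k U f"
  shows "Ck_on k U g"
  using assms(2,3)
proof (induction k arbitrary: f g)
  case 0
  then show ?case using continuous_on_cong by (metis Ck_on.simps(1))
next
  case (Suc k)
  have "g differentiable (at u)" if "u \<in> U" for u
    using has_derivative_transform_within_open[of f _ u UNIV U g] Suc.prems that assms(1)
    unfolding differentiable_def by (metis Ck_on.simps(2) differentiable_def)
  moreover have "Ck_on k U (\<lambda>u. frechet_derivative g (at u) v)" for v
  proof (rule Suc.IH)
    show "Ck_on k U (\<lambda>u. frechet_derivative f (at u) v)" using Suc.prems by simp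
    show "frechet_derivative f (at w) v = frechet_derivative g (at w) v" if "w \<in> U" for w
      using frechet_derivative_transform_within_open[of f w U g] Suc.prems that assms(1) by auto
  qed
  ultimately show ?case by simp
qed

lemma Ck_on_inner_const:
  fixes f :: "'a::euclidean_space \<Rightarrow> 'b::euclidean_space"
  assumes "open U" "Ck_on k U f"
  shows "Ck_on k U (\<lambda>w. f w \<bullet> a)"
  using assms(2)
proof (induction k arbitrary: f)
  case 0
  then show ?case by (auto intro!: continuous_intros)
next
  case (Suc k)
  have df: "((\<lambda>w. f w \<bullet> a) has_derivative (\<lambda>h. frechet_derivative f (at u) h \<bullet> a)) (at u)" if "u \<in> U" for u
    using Suc.prems that
    by (auto intro!: has_derivative_inner_left frechet_derivative_has_derivative)
  have "Ck_on k U (\<lambda>u. frechet_derivative (\<lambda>w. f w \<bullet> a) (at u) v)" for v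
  proof (rule Ck_on_cong[OF assms(1)])
    show "Ck_on k U (\<lambda>u. frechet_derivative f (at u) v \<bullet> a)" using Suc by simp
    show "frechet_derivative f (at w) v \<bullet> a = frechet_derivative (\<lambda>w. f w \<bullet> a) (at w) v" if "w \<in> U" for w
      using frechet_derivative_eqI[OF df[OF that]] by simp
  qed
  with df show ?case by (auto simp: differentiable_def)
qed

lemma smooth_on_inner_const:
  fixes f :: "'a::euclidean_space \<Rightarrow> 'b::euclidean_space"
  assumes "open U" "smooth_on U f"
  shows "smooth_on U (\<lambda>w. f w \<bullet> a)"
  using assms Ck_on_inner_const[of U _ f a] unfolding smooth_on_def by blast

lemma partial_deriv2_inner_const:
  fixes F :: "real ^ 'n::finite \<Rightarrow> 'b::euclidean_space"
  assumes "smooth_on U F" "open U" "u \<in> U"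
  shows "partial_deriv i (partial_deriv j (\<lambda>w. F w \<bullet> a)) u = partial_deriv i (partial_deriv j F) u \<bullet> a"
proof -
  have "partial_deriv i (partial_deriv j (\<lambda>w. F w \<bullet> a)) u = partial_deriv i (\<lambda>w. partial_deriv j F w \<bullet> a) u"
    using assms smooth_on_imp_differentiable[OF smooth_on_partial_deriv[OF smooth_on_inner_const[OF assms(2,1)]]]
    by (intro partial_deriv_cong[of U])
      (auto simp: partial_deriv_inner_const smooth_on_imp_differentiable[OF assms(1)])
  also have "\<dots> = partial_deriv i (partial_deriv j F) u \<bullet> a"
    by (intro partial_deriv_inner_const
        smooth_on_imp_differentiable[OF smooth_on_partial_deriv[OF assms(1)] assms(3)])
  finally show ?thesis .
qed

text \<open>A vector is determined by its inner products, so the real-valued result applied to each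
  \<open>F w \<bullet> a\<close> suffices.\<close>

lemma partial_deriv_commute:
  fixes F :: "real ^ 'n::finite \<Rightarrow> 'b::euclidean_space"
  assumes "smooth_on U F" "open U" "u \<in> U"
  shows "partial_deriv i (partial_deriv j F) u = partial_deriv j (partial_deriv i F) u"
proof (rule vector_eq_rdot[THEN iffD1], intro allI)
  fix a :: 'b
  have "partial_deriv i (partial_deriv j (\<lambda>w. F w \<bullet> a)) u = partial_deriv j (partial_deriv i (\<lambda>w. F w \<bullet> a)) u"
    unfolding partial_deriv_def
    by (rule mixed_derivatives_commute_real[OF smooth_on_inner_const[OF assms(2,1)] assms(2,3)])
  then show "partial_deriv i (partial_deriv j F) u \<bullet> a = partial_deriv j (partial_deriv i F) u \<bullet> a"
    unfolding partial_deriv2_inner_const[OF assms] .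
qed

subsection \<open>Linear algebra\<close>

lemma matrix_inv_works:
  fixes A :: "real ^ 'n::finite ^ 'n"
  assumes "invertible A"
  shows "A ** matrix_inv A = mat 1" "matrix_inv A ** A = mat 1"
  using someI_ex[OF assms[unfolded invertible_def]] by (simp_all add: matrix_inv_def)

text \<open>Cramer's rule for the \<open>l\<close>-th column of the inverse. It shows the entries of
  the inverse as quotients of determinants, which is how the inverse metric becomes
  differentiable.\<close>

lemma matrix_inv_cramer:
  fixes A :: "real ^ 'n::finite ^ 'n"
  assumes "invertible A"
  shows "matrix_inv A $ k $ l = det (\<chi> i j. if j = k then axis l 1 $ i else A $ i $ j) / det A"
proof -
  have "A *v (matrix_inv A *v axis l 1) = axis l 1"
    by (simp add: matrix_vector_mul_assoc matrix_inv_works[OF assms])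
  then have "matrix_inv A *v axis l 1 = (\<chi> k. det (\<chi> i j. if j = k then axis l 1 $ i else A $ i $ j) / det A)"
    using cramer[of A] assms by (simp add: invertible_det_nz)
  moreover have "matrix_inv A $ k $ l = (matrix_inv A *v axis l 1) $ k"
    by (simp add: matrix_vector_mul_component inner_axis)
  ultimately show ?thesis by simp
qed

lemma differentiable_det:
  fixes A :: "'a::real_normed_vector \<Rightarrow> real ^ 'n::finite ^ 'n"
  assumes "\<And>i j. (\<lambda>w. A w $ i $ j) differentiable (at u)"
  shows "(\<lambda>w. det (A w)) differentiable (at u)"
proof -
  have "(\<lambda>w. \<Prod>i\<in>UNIV. A w $ i $ p i) differentiable (at u)" for p :: "'n \<Rightarrow> 'n"
  proof -
    have "\<forall>i. \<exists>D. ((\<lambda>w. A w $ i $ p i) has_derivative D) (at u)"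
      using assms unfolding differentiable_def by blast
    from choice[OF this] obtain D where D: "\<And>i. ((\<lambda>w. A w $ i $ p i) has_derivative D i) (at u)"
      by blast
    from has_derivative_prod[of UNIV "\<lambda>i w. A w $ i $ p i" D u UNIV, OF D]
    show ?thesis unfolding differentiable_def by blast
  qed
  then show ?thesis unfolding det_def
    by (intro differentiable_sum differentiable_mult differentiable_const) (simp_all add: finite_permutations)
qed

lemma differentiable_matrix_inv:
  fixes A :: "'a::real_normed_vector \<Rightarrow> real ^ 'n::finite ^ 'n"
  assumes "open U" "u \<in> U" "\<And>w. w \<in> U \<Longrightarrow> invertible (A w)"
    and diff: "\<And>i j. (\<lambda>w. A w $ i $ j) differentiable (at u)"
  shows "(\<lambda>w. matrix_inv (A w) $ k $ l) differentiable (at u)"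
proof -
  let ?R = "\<lambda>w. det (\<chi> i j. if j = k then axis l 1 $ i else A w $ i $ j) / det (A w)"
  have "?R differentiable (at u)"
  proof (intro differentiable_divide differentiable_det diff)
    show "(\<lambda>w. (\<chi> i j. if j = k then axis l 1 $ i else A w $ i $ j) $ i $ j) differentiable (at u)" for i j
      using diff by (cases "j = k") auto
    show "det (A u) \<noteq> 0" using assms(2,3) by (simp add: invertible_det_nz)
  qed
  then obtain D where "(?R has_derivative D) (at u)" unfolding differentiable_def by blast
  then have "((\<lambda>w. matrix_inv (A w) $ k $ l) has_derivative D) (at u)"
    by (rule has_derivative_transform_within_open[OF _ assms(1,2)])
      (simp add: matrix_inv_cramer[OF assms(3)])
  then show ?thesis unfolding differentiable_def by blast
qed

text \<open>A dimension count: a nonzero \<open>w\<close> would give, with \<open>X\<close> and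
  \<open>N\<close>, three independent directions orthogonal to the \<open>n\<close>-dimensional
  range of \<open>L\<close>, inside a space of dimension \<open>n + 2\<close>.\<close>

lemma orthogonal_to_hypersurface_frame_imp_zero:
  fixes L :: "real ^ 'n::finite \<Rightarrow> real ^ 'k::finite"
  assumes "CARD('k) = CARD('n) + 2" "linear L" "inj L"
    and "X \<noteq> 0" "N \<noteq> 0" "N \<bullet> X = 0" "\<And>v. X \<bullet> L v = 0" "\<And>v. N \<bullet> L v = 0"
    and w: "w \<bullet> X = 0" "w \<bullet> N = 0" "\<And>v. w \<bullet> L v = 0"
  shows "w = 0"
proof (rule ccontr)
  assume "w \<noteq> 0"
  have "pairwise orthogonal {X, N, w}"
    using assms by (auto simp: pairwise_def orthogonal_def inner_commute)
  then have "independent {X, N, w}"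
    using assms \<open>w \<noteq> 0\<close> by (intro pairwise_orthogonal_independent) auto
  moreover have "X \<noteq> N" "X \<noteq> w" "N \<noteq> w" using assms by auto
  ultimately have "dim {X, N, w} = 3" by (simp add: dim_eq_card_independent)
  moreover have "dim (range L) = CARD('n)"
    using dim_image_eq[OF assms(2), of UNIV] assms(3) by (simp add: dim_UNIV)
  moreover have "dim (range L \<union> {X, N, w}) = dim (range L) + dim {X, N, w}"
    using assms by (intro dim_orthogonal_sum) (auto simp: inner_commute)
  moreover have "dim (range L \<union> {X, N, w}) \<le> CARD('k)"
    using dim_subset_UNIV[of "range L \<union> {X, N, w}"] by simp
  ultimately show False using assms(1) by simp
qed

subsection \<open>The structure equations in a chart\<close>

text \<open>The matrix of the shape operator, written with the inverse metric so that it is visibly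
  differentiable in the base point; the minus sign comes from \<open>A = - d\<nu>\<close>.\<close>

definition shape_matrix ::
    "('m, 'n::finite) chart \<Rightarrow> ('m \<Rightarrow> 'e::euclidean_space) \<Rightarrow> ('m \<Rightarrow> 'e) \<Rightarrow> real ^ 'n \<Rightarrow> real ^ 'n ^ 'n" where
  "shape_matrix c x \<nu> u =
     (\<chi> k i. - (\<Sum>l\<in>UNIV. matrix_inv (induced_metric c x u) $ k $ l *
        (partial_deriv i (local_expr c \<nu>) u \<bullet> partial_deriv l (local_expr c x) u)))"

text \<open>The Laplacian of an \<open>\<real>\<^sup>k\<close>-valued map, whose inner product with \<open>a\<close> is the Laplacian
  of the height function in direction \<open>a\<close>.\<close>

definition vector_laplacian ::
    "('m, 'n::finite) chart \<Rightarrow> ('m \<Rightarrow> 'e::euclidean_space) \<Rightarrow> (real ^ 'n \<Rightarrow> 'e) \<Rightarrow> real ^ 'n \<Rightarrow> 'e" where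
  "vector_laplacian c x F u =
     (\<Sum>i\<in>UNIV. \<Sum>j\<in>UNIV. matrix_inv (induced_metric c x u) $ i $ j *\<^sub>R
        (partial_deriv j (partial_deriv i F) u
         - (\<Sum>k\<in>UNIV. christoffel c x k j i u *\<^sub>R partial_deriv k F u)))"

locale hypersurface_chart =
  fixes c :: "('m, 'n::finite) chart" and x \<nu> :: "'m \<Rightarrow> real ^ 'k::finite"
  assumes dim: "CARD('k) = CARD('n) + 2"
    and inj_coord: "inj_on (coord c) (chart_dom c)"
    and open_codom: "open (chart_codom c)"
    and smooth_x: "smooth_on (chart_codom c) (local_expr c x)"
    and smooth_normal: "smooth_on (chart_codom c) (local_expr c \<nu>)"
    and X_X: "\<And>u. u \<in> chart_codom c \<Longrightarrow> local_expr c x u \<bullet> local_expr c x u = 1"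
    and N_N: "\<And>u. u \<in> chart_codom c \<Longrightarrow> local_expr c \<nu> u \<bullet> local_expr c \<nu> u = 1"
    and N_X: "\<And>u. u \<in> chart_codom c \<Longrightarrow> local_expr c \<nu> u \<bullet> local_expr c x u = 0"
    and N_DX: "\<And>u v. u \<in> chart_codom c \<Longrightarrow> local_expr c \<nu> u \<bullet> frechet_derivative (local_expr c x) (at u) v = 0"
    and inj_DX: "\<And>u. u \<in> chart_codom c \<Longrightarrow> inj (frechet_derivative (local_expr c x) (at u))"
begin

abbreviation "U \<equiv> chart_codom c"
abbreviation "X \<equiv> local_expr c x"
abbreviation "N \<equiv> local_expr c \<nu>"
abbreviation "DX \<equiv> \<lambda>u. frechet_derivative X (at u)"
abbreviation "DN \<equiv> \<lambda>u. frechet_derivative N (at u)"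
abbreviation "dX \<equiv> \<lambda>i. partial_deriv i X"
abbreviation "dN \<equiv> \<lambda>i. partial_deriv i N"
abbreviation "ddX \<equiv> \<lambda>i j. partial_deriv i (partial_deriv j X)"
abbreviation "ddN \<equiv> \<lambda>i j. partial_deriv i (partial_deriv j N)"
abbreviation "g \<equiv> induced_metric c x"
abbreviation "G \<equiv> \<lambda>u. matrix_inv (induced_metric c x u)"
abbreviation "\<Gamma> \<equiv> christoffel c x"
abbreviation "A \<equiv> shape_matrix c x \<nu>"

lemmas smooth_dX = smooth_on_partial_deriv[OF smooth_x]
lemmas smooth_dN = smooth_on_partial_deriv[OF smooth_normal]
lemmas diff_X = smooth_on_imp_differentiable[OF smooth_x]
lemmas diff_N = smooth_on_imp_differentiable[OF smooth_normal]
lemmas diff_dX = smooth_on_imp_differentiable[OF smooth_dX]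
lemmas diff_dN = smooth_on_imp_differentiable[OF smooth_dN]

context
  fixes u assumes u: "u \<in> U"
begin

lemma X_dX: "X u \<bullet> dX i u = 0"
  using partial_deriv_inner_const_zero[OF smooth_x smooth_x open_codom u X_X, of i]
  by (simp add: inner_commute)

lemma N_dX: "N u \<bullet> dX i u = 0"
  using N_DX[OF u] by (simp add: partial_deriv_def)

lemma dX_X: "dX i u \<bullet> X u = 0" and dX_N: "dX i u \<bullet> N u = 0"
  using X_dX[of i] N_dX[of i] by (simp_all add: inner_commute)

lemma N_dN: "N u \<bullet> dN i u = 0"
  using partial_deriv_inner_const_zero[OF smooth_normal smooth_normal open_codom u N_N, of i]
  by (simp add: inner_commute)

lemma X_dN: "X u \<bullet> dN i u = 0"
  using partial_deriv_inner_const_zero[OF smooth_normal smooth_x open_codom u N_X, of i] N_dX[of i]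
  by (simp add: inner_commute)

lemma ddX_commute: "ddX i j u = ddX j i u"
  by (rule partial_deriv_commute[OF smooth_x open_codom u])

lemma ddN_commute: "ddN i j u = ddN j i u"
  by (rule partial_deriv_commute[OF smooth_normal open_codom u])

end

section \<open>Second-order relations, Gauss and Weingarten formulas\<close>

context
  fixes u assumes u: "u \<in> U"
begin

text \<open>The first-order relations hold at every point of \<open>U\<close> and can therefore be
  differentiated again; for this the point \<open>u\<close> was released and is now fixed
  anew.\<close>

lemma X_ddX: "X u \<bullet> ddX i j u = - (dX i u \<bullet> dX j u)"
  using partial_deriv_inner_const_zero[OF smooth_x smooth_dX open_codom u X_dX, of i j] by simp

lemma N_ddX: "N u \<bullet> ddX i j u = - (dN i u \<bullet> dX j u)"
  using partial_deriv_inner_const_zero[OF smooth_normal smooth_dX open_codom u N_dX, of i j] by simp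

lemma X_ddN: "X u \<bullet> ddN i j u = - (dX i u \<bullet> dN j u)"
  using partial_deriv_inner_const_zero[OF smooth_x smooth_dN open_codom u X_dN, of i j] by simp

lemma X_ddN': "X u \<bullet> ddN i j u = - (dN j u \<bullet> dX i u)"
  by (simp add: X_ddN inner_commute)

lemma N_ddN: "N u \<bullet> ddN i j u = - (dN i u \<bullet> dN j u)"
  using partial_deriv_inner_const_zero[OF smooth_normal smooth_dN open_codom u N_dN, of i j] by simp

lemma N_ddN': "N u \<bullet> ddN i j u = - (dN j u \<bullet> dN i u)"
  by (simp add: N_ddN inner_commute)

text \<open>Symmetry of the second fundamental form: both sides equal minus the normal component of
  a second derivative of \<open>X\<close>, and these derivatives commute.\<close>

lemma dN_dX_commute: "dN i u \<bullet> dX j u = dN j u \<bullet> dX i u"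
  using N_ddX[of i j] N_ddX[of j i] ddX_commute[OF u, of i j] by simp

lemma dX_dN: "dX i u \<bullet> dN j u = dN i u \<bullet> dX j u"
  using dN_dX_commute[of i j] by (simp add: inner_commute)

lemma DX_eq: "DX u v = (\<Sum>i\<in>UNIV. v $ i *\<^sub>R dX i u)"
  by (rule frechet_derivative_eq_sum_partial_deriv[OF diff_X[OF u]])

lemma DN_eq: "DN u v = (\<Sum>i\<in>UNIV. v $ i *\<^sub>R dN i u)"
  by (rule frechet_derivative_eq_sum_partial_deriv[OF diff_N[OF u]])

text \<open>The frame spans the ambient space, so vector identities may be checked against
  \<open>X\<close>, \<open>N\<close> and the \<open>dX l\<close> alone.\<close>

lemma frame_zero:
  assumes "w \<bullet> X u = 0" "w \<bullet> N u = 0" "\<And>l. w \<bullet> dX l u = 0"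
  shows "w = 0"
proof (rule orthogonal_to_hypersurface_frame_imp_zero[OF dim linear_frechet_derivative[OF diff_X[OF u]] inj_DX[OF u]])
  show "X u \<noteq> 0" "N u \<noteq> 0" using X_X[OF u] N_N[OF u] by auto
  show "N u \<bullet> X u = 0" by (rule N_X[OF u])
  show "X u \<bullet> DX u v = 0" "N u \<bullet> DX u v = 0" "w \<bullet> DX u v = 0" for v
    using assms X_dX[OF u] N_dX[OF u] by (simp_all add: DX_eq inner_sum_right)
qed fact+

lemma metric_component: "g u $ i $ j = dX i u \<bullet> dX j u"
  by (simp add: induced_metric_def)

text \<open>The metric is a Gram matrix: a kernel vector \<open>v\<close> satisfies
  \<open>DX u v \<bullet> DX u v = 0\<close>, and the immersion has injective differential.\<close>

lemma invertible_metric: "invertible (g u)"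
proof -
  have "v = 0" if "g u *v v = 0" for v
  proof -
    have "dX i u \<bullet> DX u v = 0" for i
      using arg_cong[OF that, of "\<lambda>z. z $ i"]
      by (simp add: matrix_vector_mult_def metric_component DX_eq inner_sum_right mult.commute)
    then have "(\<Sum>i\<in>UNIV. v $ i *\<^sub>R dX i u) \<bullet> DX u v = 0" by (simp add: inner_sum_left)
    then have "DX u v \<bullet> DX u v = 0" using DX_eq[of v] by simp
    then have "DX u v = DX u 0" using linear_0[OF linear_frechet_derivative[OF diff_X[OF u]]] by simp
    then show "v = 0" using inj_DX[OF u] by (simp add: inj_eq)
  qed
  then show ?thesis
    using invertible_left_inverse matrix_left_invertible_ker by blast
qed

lemma metric_symmetric: "transpose (g u) = g u"
  by (simp add: transpose_def vec_eq_iff metric_component inner_commute)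

lemma inverse_metric_symmetric: "G u $ i $ j = G u $ j $ i"
proof -
  note inv = matrix_inv_works[OF invertible_metric]
  have "transpose (G u) ** g u = mat 1"
    using arg_cong[OF inv(1), of transpose] by (simp add: matrix_transpose_mul metric_symmetric)
  then have "transpose (G u) = G u"
    using inv(1) matrix_mul_assoc[of "transpose (G u)" "g u" "G u"] by simp
  from arg_cong[OF this, of "\<lambda>M. M $ j $ i"] show ?thesis by (simp add: transpose_def)
qed

lemma inverse_metric_sum: "(\<Sum>k\<in>UNIV. G u $ i $ k * (dX k u \<bullet> dX j u)) = (if i = j then 1 else 0)"
  using arg_cong[OF matrix_inv_works(2)[OF invertible_metric], of "\<lambda>M. M $ i $ j"]
  by (simp add: matrix_matrix_mult_def metric_component mat_def)

text \<open>Raising an index: the proposed combination has the same inner products with the whole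
  frame as \<open>w\<close>, so \<open>frame_zero\<close> applies to the difference.\<close>

lemma tangent_expansion:
  assumes "w \<bullet> X u = 0" "w \<bullet> N u = 0"
  shows "w = (\<Sum>k\<in>UNIV. (\<Sum>l\<in>UNIV. G u $ k $ l * (w \<bullet> dX l u)) *\<^sub>R dX k u)"
proof -
  let ?z = "\<Sum>k\<in>UNIV. (\<Sum>l\<in>UNIV. G u $ k $ l * (w \<bullet> dX l u)) *\<^sub>R dX k u"
  have "?z \<bullet> dX m u = w \<bullet> dX m u" for m
  proof -
    have "?z \<bullet> dX m u = (\<Sum>k\<in>UNIV. \<Sum>l\<in>UNIV. G u $ k $ l * (w \<bullet> dX l u) * (dX k u \<bullet> dX m u))"
      by (simp add: inner_sum_left sum_distrib_right)
    also have "\<dots> = (\<Sum>l\<in>UNIV. (w \<bullet> dX l u) * (\<Sum>k\<in>UNIV. G u $ l $ k * (dX k u \<bullet> dX m u)))"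
      by (subst sum.swap) (simp add: sum_distrib_left inverse_metric_symmetric mult.assoc mult.left_commute)
    also have "\<dots> = w \<bullet> dX m u" by (simp add: inverse_metric_sum if_distrib cong: if_cong)
    finally show ?thesis .
  qed
  moreover have "?z \<bullet> X u = 0" "?z \<bullet> N u = 0"
    using dX_X[OF u] dX_N[OF u] by (simp_all add: inner_sum_left)
  ultimately have "w - ?z = 0"
    using assms by (intro frame_zero) (simp_all add: inner_diff_left)
  then show ?thesis by simp
qed

text \<open>The derivatives of \<open>N\<close> are orthogonal to \<open>X\<close> and
  \<open>N\<close>, hence tangent, and their expansion coefficients are the entries of
  \<open>A\<close> up to sign.\<close>

lemma weingarten: "dN i u = - (\<Sum>k\<in>UNIV. A u $ k $ i *\<^sub>R dX k u)"
proof -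
  have "dN i u = (\<Sum>k\<in>UNIV. (\<Sum>l\<in>UNIV. G u $ k $ l * (dN i u \<bullet> dX l u)) *\<^sub>R dX k u)"
    using X_dN[OF u] N_dN[OF u] by (intro tangent_expansion) (simp_all add: inner_commute)
  then show ?thesis by (simp add: shape_matrix_def sum_negf)
qed

text \<open>Writing the metric as inner products of the \<open>dX i\<close> and using commuting
  second derivatives, the three metric derivatives combine to twice one inner product. Thus
  \<open>\<Gamma>\<close> collects the tangential components of \<open>ddX i j\<close>.\<close>

lemma christoffel_eq: "\<Gamma> k i j u = (\<Sum>l\<in>UNIV. G u $ k $ l * (ddX i j u \<bullet> dX l u))"
proof -
  have d: "partial_deriv i (\<lambda>w. g w $ j $ l) u = ddX i j u \<bullet> dX l u + dX j u \<bullet> ddX i l u" for i j l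
    using partial_deriv_inner[OF diff_dX[OF u] diff_dX[OF u], of i j l] by (simp add: induced_metric_def)
  have "partial_deriv i (\<lambda>w. g w $ j $ l) u + partial_deriv j (\<lambda>w. g w $ i $ l) u
      - partial_deriv l (\<lambda>w. g w $ i $ j) u = 2 * (ddX i j u \<bullet> dX l u)" for l
    unfolding d ddX_commute[OF u, of j i] ddX_commute[OF u, of l] by (simp add: inner_commute)
  then show ?thesis by (simp add: christoffel_def sum_divide_distrib)
qed

text \<open>Against a tangent vector only the tangential part of \<open>ddX i j u\<close> counts,
  and by \<open>christoffel_eq\<close> its coefficients are the Christoffel symbols.\<close>

lemma christoffel_tangent:
  assumes "w \<bullet> X u = 0" "w \<bullet> N u = 0"
  shows "(\<Sum>k\<in>UNIV. \<Gamma> k i j u * (dX k u \<bullet> w)) = ddX i j u \<bullet> w"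
proof -
  have "ddX i j u \<bullet> w = (\<Sum>k\<in>UNIV. \<Sum>l\<in>UNIV. G u $ k $ l * (w \<bullet> dX l u) * (ddX i j u \<bullet> dX k u))"
    by (subst tangent_expansion[OF assms]) (simp add: inner_sum_right sum_distrib_right)
  also have "\<dots> = (\<Sum>k\<in>UNIV. \<Gamma> k i j u * (dX k u \<bullet> w))"
    by (subst sum.swap)
      (simp add: christoffel_eq sum_distrib_left sum_distrib_right inverse_metric_symmetric inner_commute mult_ac)
  finally show ?thesis by simp
qed

lemma vector_laplacian_inner:
  "vector_laplacian c x F u \<bullet> w = (\<Sum>i\<in>UNIV. \<Sum>j\<in>UNIV. G u $ i $ j *
     (partial_deriv j (partial_deriv i F) u \<bullet> w - (\<Sum>k\<in>UNIV. \<Gamma> k j i u * (partial_deriv k F u \<bullet> w))))"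
  by (simp add: vector_laplacian_def inner_sum_left inner_diff_left)

lemma trace_shape: "trace (A u) = - (\<Sum>i\<in>UNIV. \<Sum>j\<in>UNIV. G u $ i $ j * (dN i u \<bullet> dX j u))"
  by (simp add: trace_def shape_matrix_def sum_negf)

text \<open>The Christoffel terms remove exactly the tangential part of the second derivatives, so
  the covariant Hessian of \<open>X\<close> is normal to the hypersurface.\<close>

lemma laplacian_X_dX: "vector_laplacian c x X u \<bullet> dX l u = 0"
  unfolding vector_laplacian_inner
  using X_dX[OF u] N_dX[OF u] by (simp add: christoffel_tangent inner_commute)

text \<open>By \<open>X_ddX\<close> the trace becomes minus the contraction of the metric with its
  inverse, which is the dimension.\<close>

lemma laplacian_X_X: "vector_laplacian c x X u \<bullet> X u = - real CARD('n)"
proof -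
  have "vector_laplacian c x X u \<bullet> X u = - (\<Sum>i\<in>UNIV. \<Sum>j\<in>UNIV. G u $ i $ j * (dX j u \<bullet> dX i u))"
    unfolding vector_laplacian_inner
    using X_dX[OF u] X_ddX by (simp add: inner_commute[of _ "X u"] sum_negf)
  then show ?thesis by (simp add: inverse_metric_sum)
qed

lemma laplacian_X_N: "vector_laplacian c x X u \<bullet> N u = trace (A u)"
  unfolding vector_laplacian_inner trace_shape
  using N_dX[OF u] N_ddX by (simp add: inner_commute[of _ "N u"] sum_negf dN_dX_commute)

lemma laplacian_N_X: "vector_laplacian c x N u \<bullet> X u = trace (A u)"
  unfolding vector_laplacian_inner trace_shape
  using X_dN[OF u] X_ddN' by (simp add: inner_commute[of _ "X u"] sum_negf)

text \<open>One factor \<open>dN i u\<close> is expanded by \<open>weingarten\<close>; contracting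
  the other with the inverse metric, after moving the derivative by \<open>dX_dN\<close>, yields the
  second copy of \<open>A\<close>.\<close>

lemma trace_shape_square:
  "trace (A u ** A u) = (\<Sum>i\<in>UNIV. \<Sum>j\<in>UNIV. G u $ i $ j * (dN i u \<bullet> dN j u))"
proof -
  have "(\<Sum>i\<in>UNIV. \<Sum>j\<in>UNIV. G u $ i $ j * (dN i u \<bullet> dN j u))
      = (\<Sum>i\<in>UNIV. \<Sum>j\<in>UNIV. \<Sum>k\<in>UNIV. - (A u $ k $ i * (G u $ i $ j * (dX k u \<bullet> dN j u))))"
    by (subst weingarten) (simp add: inner_sum_left sum_distrib_left sum_negf mult_ac)
  also have "\<dots> = (\<Sum>i\<in>UNIV. \<Sum>k\<in>UNIV. \<Sum>j\<in>UNIV. - (A u $ k $ i * (G u $ i $ j * (dX k u \<bullet> dN j u))))"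
    by (intro sum.cong refl sum.swap)
  also have "\<dots> = (\<Sum>i\<in>UNIV. \<Sum>k\<in>UNIV. A u $ k $ i * A u $ i $ k)"
    by (simp add: shape_matrix_def[of c x \<nu> u] sum_distrib_left sum_negf dX_dN)
  also have "\<dots> = trace (A u ** A u)"
    by (simp add: trace_def matrix_matrix_mult_def mult.commute)
  finally show ?thesis by simp
qed

lemma laplacian_N_N: "vector_laplacian c x N u \<bullet> N u = - trace (A u ** A u)"
  unfolding vector_laplacian_inner trace_shape_square
  using N_dN[OF u] N_ddN' by (simp add: inner_commute[of _ "N u"] sum_negf)

end

section \<open>Codazzi equation and the Laplacian of the normal\<close>

lemma differentiable_inverse_metric: "u \<in> U \<Longrightarrow> (\<lambda>w. G w $ i $ j) differentiable (at u)"
proof (rule differentiable_matrix_inv[OF open_codom _ invertible_metric])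
  assume u: "u \<in> U"
  show "(\<lambda>w. g w $ i $ j) differentiable (at u)" for i j
    by (simp add: induced_metric_def differentiable_inner diff_dX[OF u])
qed

lemma differentiable_shape: "u \<in> U \<Longrightarrow> (\<lambda>w. A w $ i $ j) differentiable (at u)"
  unfolding shape_matrix_def
  by (auto intro!: differentiable_sum differentiable_minus differentiable_mult differentiable_inner
      differentiable_inverse_metric diff_dX diff_dN)

lemma differentiable_trace_shape: "u \<in> U \<Longrightarrow> (\<lambda>w. trace (A w)) differentiable (at u)"
  unfolding trace_def by (auto intro!: differentiable_sum differentiable_shape)

context
  fixes u assumes u: "u \<in> U"
begin

text \<open>Derivative in direction \<open>i\<close> of the symmetry of the second fundamental form.
  Combined with \<open>ddN_commute\<close> it is the Codazzi equation, the terms in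
  \<open>ddX\<close> carrying the Christoffel corrections.\<close>

lemma codazzi: "ddN i j u \<bullet> dX l u + dN j u \<bullet> ddX i l u = ddN i l u \<bullet> dX j u + dN l u \<bullet> ddX i j u"
proof -
  have d: "partial_deriv i (\<lambda>w. dN j w \<bullet> dX l w) u = ddN i j u \<bullet> dX l u + dN j u \<bullet> ddX i l u" for j l
    by (rule partial_deriv_inner[OF diff_dN[OF u] diff_dX[OF u]])
  have "partial_deriv i (\<lambda>w. dN j w \<bullet> dX l w) u = partial_deriv i (\<lambda>w. dN l w \<bullet> dX j w) u"
    by (intro partial_deriv_cong[OF open_codom u])
      (auto intro!: dN_dX_commute differentiable_inner diff_dN[OF u] diff_dX[OF u])
  then show ?thesis unfolding d .
qed

lemma ddN_eq: "ddN l i u = - (\<Sum>k\<in>UNIV. partial_deriv l (\<lambda>w. A w $ k $ i) u *\<^sub>R dX k u + A u $ k $ i *\<^sub>R ddX l k u)"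
proof -
  have d: "(\<lambda>w. A w $ k $ i *\<^sub>R dX k w) differentiable (at u)" for k
    by (intro differentiable_scaleR differentiable_shape[OF u] diff_dX[OF u])
  have "ddN l i u = partial_deriv l (\<lambda>w. - (\<Sum>k\<in>UNIV. A w $ k $ i *\<^sub>R dX k w)) u"
    by (intro partial_deriv_cong[OF open_codom u]) (auto intro: weingarten diff_dN[OF u])
  also have "\<dots> = - (\<Sum>k\<in>UNIV. partial_deriv l (\<lambda>w. A w $ k $ i *\<^sub>R dX k w) u)"
    by (simp add: partial_deriv_minus partial_deriv_sum d)
  finally show ?thesis
    by (simp add: partial_deriv_scaleR[OF differentiable_shape[OF u] diff_dX[OF u]])
qed

text \<open>\<open>A\<close> times the inverse metric is the second fundamental form with both
  indices raised, which inherits its symmetry.\<close>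

lemma shape_inverse_metric_symmetric:
  "(\<Sum>j\<in>UNIV. A u $ k $ j * G u $ j $ i) = (\<Sum>j\<in>UNIV. A u $ i $ j * G u $ j $ k)"
proof -
  have "(\<Sum>j\<in>UNIV. A u $ k $ j * G u $ j $ i)
      = (\<Sum>j\<in>UNIV. \<Sum>m\<in>UNIV. - (G u $ k $ m * (dN j u \<bullet> dX m u) * G u $ j $ i))" for k i
    by (simp add: shape_matrix_def sum_distrib_right sum_negf)
  note this[of k i] this[of i k]
  moreover have "(\<Sum>j\<in>UNIV. \<Sum>m\<in>UNIV. - (G u $ k $ m * (dN j u \<bullet> dX m u) * G u $ j $ i))
      = (\<Sum>j\<in>UNIV. \<Sum>m\<in>UNIV. - (G u $ i $ m * (dN j u \<bullet> dX m u) * G u $ j $ k))"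
    by (subst sum.swap) (intro sum.cong refl, simp add: dN_dX_commute[OF u] inverse_metric_symmetric[OF u] mult_ac)
  ultimately show ?thesis by simp
qed

text \<open>The traced Codazzi equation. Codazzi turns the direction of differentiation into
  \<open>l\<close>; inserting Weingarten then leaves the derivative of the trace and two triple sums
  in \<open>A\<close> and \<open>ddX\<close>, which cancel.\<close>

lemma laplacian_N_dX: "vector_laplacian c x N u \<bullet> dX l u = - partial_deriv l (\<lambda>w. trace (A w)) u"
proof -
  \<comment> \<open>The symmetry \<open>dN_dX_commute\<close> moves the normal derivative onto the
    index \<open>l\<close>, so the sum is \<open>christoffel_tangent\<close> for the tangent vector
    \<open>dN l u\<close>.\<close>
  have tangent: "(\<Sum>k\<in>UNIV. \<Gamma> k j i u * (dN k u \<bullet> dX l u)) = dN l u \<bullet> ddX j i u" for i j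
    using christoffel_tangent[OF u, of "dN l u" j i] X_dN[OF u] N_dN[OF u]
    by (simp add: dN_dX_commute[OF u, of _ l] inner_commute)
  have "vector_laplacian c x N u \<bullet> dX l u
      = (\<Sum>i\<in>UNIV. \<Sum>j\<in>UNIV. G u $ i $ j * (ddN l j u \<bullet> dX i u - dN i u \<bullet> ddX l j u))"
    unfolding vector_laplacian_inner[OF u] tangent
  proof (intro sum.cong refl)
    fix i j
    \<comment> \<open>Codazzi exchanges \<open>i\<close> and \<open>l\<close>; from here on
      \<open>i\<close> and \<open>j\<close> are only contracted.\<close>
    show "G u $ i $ j * (ddN j i u \<bullet> dX l u - dN l u \<bullet> ddX j i u) = G u $ i $ j * (ddN l j u \<bullet> dX i u - dN i u \<bullet> ddX l j u)"
      using codazzi[of j i l] ddN_commute[OF u, of j l] ddX_commute[OF u, of j l] by simp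
  qed
  also have "\<dots> = (\<Sum>i\<in>UNIV. \<Sum>j\<in>UNIV. G u $ i $ j * (ddN l j u \<bullet> dX i u))
      - (\<Sum>i\<in>UNIV. \<Sum>j\<in>UNIV. G u $ i $ j * (dN i u \<bullet> ddX l j u))"
    by (simp add: right_diff_distrib sum_subtractf)
  \<comment> \<open>The differentiated Weingarten formula splits this into a part with derivatives
    of \<open>A\<close> and a part with second derivatives of \<open>X\<close>.\<close>
  also have "(\<Sum>i\<in>UNIV. \<Sum>j\<in>UNIV. G u $ i $ j * (ddN l j u \<bullet> dX i u))
      = - (\<Sum>i\<in>UNIV. \<Sum>j\<in>UNIV. \<Sum>k\<in>UNIV. G u $ i $ j * partial_deriv l (\<lambda>w. A w $ k $ j) u * (dX k u \<bullet> dX i u))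
        - (\<Sum>i\<in>UNIV. \<Sum>j\<in>UNIV. \<Sum>k\<in>UNIV. G u $ i $ j * A u $ k $ j * (ddX l k u \<bullet> dX i u))"
    unfolding ddN_eq
    by (simp add: inner_sum_left sum_distrib_left sum_negf inner_diff_left right_diff_distrib sum_subtractf
        inner_add_left distrib_left sum.distrib mult_ac)
  \<comment> \<open>Summing over \<open>i\<close> contracts the metric with its inverse and forces
    \<open>k = j\<close>, leaving the diagonal of \<open>A\<close>.\<close>
  also have "(\<Sum>i\<in>UNIV. \<Sum>j\<in>UNIV. \<Sum>k\<in>UNIV. G u $ i $ j * partial_deriv l (\<lambda>w. A w $ k $ j) u * (dX k u \<bullet> dX i u))
      = partial_deriv l (\<lambda>w. trace (A w)) u"
  proof -
    have "(\<Sum>i\<in>UNIV. \<Sum>j\<in>UNIV. \<Sum>k\<in>UNIV. G u $ i $ j * partial_deriv l (\<lambda>w. A w $ k $ j) u * (dX k u \<bullet> dX i u))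
       = (\<Sum>j\<in>UNIV. \<Sum>i\<in>UNIV. \<Sum>k\<in>UNIV. G u $ i $ j * partial_deriv l (\<lambda>w. A w $ k $ j) u * (dX k u \<bullet> dX i u))"
      by (rule sum.swap)
    also have "\<dots> = (\<Sum>j\<in>UNIV. \<Sum>k\<in>UNIV. \<Sum>i\<in>UNIV. G u $ i $ j * partial_deriv l (\<lambda>w. A w $ k $ j) u * (dX k u \<bullet> dX i u))"
      by (intro sum.cong refl sum.swap)
    also have "\<dots> = (\<Sum>j\<in>UNIV. \<Sum>k\<in>UNIV. partial_deriv l (\<lambda>w. A w $ k $ j) u * (\<Sum>i\<in>UNIV. G u $ j $ i * (dX i u \<bullet> dX k u)))"
      unfolding sum_distrib_left
      by (intro sum.cong refl) (simp add: inverse_metric_symmetric[OF u] inner_commute)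
    also have "\<dots> = (\<Sum>j\<in>UNIV. partial_deriv l (\<lambda>w. A w $ j $ j) u)"
      by (simp add: inverse_metric_sum[OF u] if_distrib cong: if_cong)
    also have "\<dots> = partial_deriv l (\<lambda>w. trace (A w)) u"
      unfolding trace_def by (rule partial_deriv_sum[symmetric]) (rule differentiable_shape[OF u])
    finally show ?thesis .
  qed
  also have "(\<Sum>i\<in>UNIV. \<Sum>j\<in>UNIV. G u $ i $ j * (dN i u \<bullet> ddX l j u))
      = - (\<Sum>i\<in>UNIV. \<Sum>j\<in>UNIV. \<Sum>k\<in>UNIV. G u $ i $ j * A u $ k $ i * (dX k u \<bullet> ddX l j u))"
    by (subst weingarten[OF u]) (simp add: inner_sum_left sum_distrib_left sum_negf mult_ac)
  \<comment> \<open>After reordering, both triple sums pair \<open>ddX\<close> with the raised shape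
    matrix \<open>?P\<close>; its symmetry makes them equal, so they cancel.\<close>
  also have "(\<Sum>i\<in>UNIV. \<Sum>j\<in>UNIV. \<Sum>k\<in>UNIV. G u $ i $ j * A u $ k $ i * (dX k u \<bullet> ddX l j u))
      = (\<Sum>i\<in>UNIV. \<Sum>j\<in>UNIV. \<Sum>k\<in>UNIV. G u $ i $ j * A u $ k $ j * (ddX l k u \<bullet> dX i u))"
  proof -
    let ?P = "\<lambda>k i. \<Sum>j\<in>UNIV. A u $ k $ j * G u $ j $ i"
    have "(\<Sum>i\<in>UNIV. \<Sum>j\<in>UNIV. \<Sum>k\<in>UNIV. G u $ i $ j * A u $ k $ i * (dX k u \<bullet> ddX l j u))
       = (\<Sum>j\<in>UNIV. \<Sum>i\<in>UNIV. \<Sum>k\<in>UNIV. G u $ i $ j * A u $ k $ i * (dX k u \<bullet> ddX l j u))"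
      by (rule sum.swap)
    also have "\<dots> = (\<Sum>j\<in>UNIV. \<Sum>k\<in>UNIV. \<Sum>i\<in>UNIV. G u $ i $ j * A u $ k $ i * (dX k u \<bullet> ddX l j u))"
      by (intro sum.cong refl sum.swap)
    also have "\<dots> = (\<Sum>j\<in>UNIV. \<Sum>k\<in>UNIV. ?P k j * (dX k u \<bullet> ddX l j u))"
      unfolding sum_distrib_right by (intro sum.cong refl) (simp add: mult_ac)
    also have "\<dots> = (\<Sum>j\<in>UNIV. \<Sum>k\<in>UNIV. ?P j k * (dX k u \<bullet> ddX l j u))"
      by (subst shape_inverse_metric_symmetric) (rule refl)
    also have "\<dots> = (\<Sum>i\<in>UNIV. \<Sum>k\<in>UNIV. ?P k i * (ddX l k u \<bullet> dX i u))"
      by (subst sum.swap) (simp add: inner_commute)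
    also have "\<dots> = (\<Sum>i\<in>UNIV. \<Sum>k\<in>UNIV. \<Sum>j\<in>UNIV. G u $ i $ j * A u $ k $ j * (ddX l k u \<bullet> dX i u))"
      unfolding sum_distrib_right
      by (intro sum.cong refl) (simp add: inverse_metric_symmetric[OF u] mult_ac)
    also have "\<dots> = (\<Sum>i\<in>UNIV. \<Sum>j\<in>UNIV. \<Sum>k\<in>UNIV. G u $ i $ j * A u $ k $ j * (ddX l k u \<bullet> dX i u))"
      by (intro sum.cong refl sum.swap)
    finally show ?thesis .
  qed
  finally show ?thesis by simp
qed

lemma laplacian_X_eq: "vector_laplacian c x X u = - real CARD('n) *\<^sub>R X u + trace (A u) *\<^sub>R N u"
proof -
  have "vector_laplacian c x X u - (- real CARD('n) *\<^sub>R X u + trace (A u) *\<^sub>R N u) = 0"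
    using X_X[OF u] N_N[OF u] N_X[OF u] X_dX[OF u] N_dX[OF u]
    by (intro frame_zero[OF u])
      (simp_all add: inner_diff_left inner_add_left laplacian_X_X[OF u] laplacian_X_N[OF u]
        laplacian_X_dX[OF u] inner_commute[of "X u" "N u"])
  then show ?thesis by simp
qed

text \<open>Since \<open>X u\<close> and \<open>N u\<close> are orthonormal and normal to the
  hypersurface, pairing with them reads off \<open>m\<close> and \<open>s\<close>, while pairing
  with \<open>dX l u\<close> leaves only the derivative of the trace.\<close>

lemma laplacian_N_eq_iff:
  "vector_laplacian c x N u = - s *\<^sub>R N u + m *\<^sub>R X u \<longleftrightarrow>
     s = trace (A u ** A u) \<and> m = trace (A u) \<and> (\<forall>l. partial_deriv l (\<lambda>w. trace (A w)) u = 0)"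
  (is "?L = ?R \<longleftrightarrow> _")
proof
  assume eq: "?L = ?R"
  have "?R \<bullet> N u = - trace (A u ** A u)" "?R \<bullet> X u = trace (A u)"
    "?R \<bullet> dX l u = - partial_deriv l (\<lambda>w. trace (A w)) u" for l
    unfolding eq[symmetric] by (rule laplacian_N_N[OF u] laplacian_N_X[OF u] laplacian_N_dX)+
  then show "s = trace (A u ** A u) \<and> m = trace (A u) \<and> (\<forall>l. partial_deriv l (\<lambda>w. trace (A w)) u = 0)"
    using X_X[OF u] N_N[OF u] N_X[OF u] X_dX[OF u] N_dX[OF u]
    by (simp add: inner_diff_left inner_commute[of "X u" "N u"])
next
  assume "s = trace (A u ** A u) \<and> m = trace (A u) \<and> (\<forall>l. partial_deriv l (\<lambda>w. trace (A w)) u = 0)"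
  then have "?L - ?R = 0"
    using X_X[OF u] N_N[OF u] N_X[OF u] X_dX[OF u] N_dX[OF u]
    by (intro frame_zero[OF u])
      (simp_all add: inner_diff_left inner_add_left laplacian_N_X[OF u] laplacian_N_N[OF u]
        laplacian_N_dX inner_commute[of "X u" "N u"])
  then show "?L = ?R" by simp
qed

text \<open>Weingarten's formula for arbitrary directions, the form in which shape matrices of
  different charts can be compared.\<close>

lemma DN_eq_shape: "DN u v = - DX u (A u *v v)"
proof -
  have "DN u v = - (\<Sum>i\<in>UNIV. \<Sum>k\<in>UNIV. (v $ i * A u $ k $ i) *\<^sub>R dX k u)"
    unfolding DN_eq[OF u] by (subst weingarten[OF u]) (simp add: scaleR_sum_right sum_negf)
  also have "\<dots> = - DX u (A u *v v)"
    unfolding DX_eq[OF u]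
    by (subst sum.swap) (simp add: matrix_vector_mult_def scaleR_sum_left mult.commute)
  finally show ?thesis .
qed

end

end

section \<open>The defined operators in terms of the chart formulas\<close>

context hypersurface_chart
begin

lemma codom_point: "p \<in> chart_dom c \<Longrightarrow> coord c p \<in> U"
  by (simp add: chart_codom_def)

lemma local_expr_coord: "p \<in> chart_dom c \<Longrightarrow> local_expr c f (coord c p) = f p"
  by (simp add: local_expr_def inj_coord)

text \<open>By \<open>DN_eq_shape\<close> the derivative of \<open>\<nu>\<close> is already tangent,
  so the projection in \<open>sphere_connection\<close> leaves it unchanged; injectivity of the
  differential of \<open>x\<close> makes the described vector unique.\<close>

lemma shape_operator_eq:
  assumes p: "p \<in> chart_dom c"
  shows "shape_operator c x \<nu> p v = A (coord c p) *v v"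
  unfolding shape_operator_def
proof (rule the_equality)
  note u = codom_point[OF p]
  have "x p \<bullet> DX (coord c p) w = 0" for w
    using X_dX[OF u] by (simp add: DX_eq[OF u] inner_sum_right local_expr_coord[OF p])
  then have conn: "sphere_connection c x \<nu> p v = - differential c x p (A (coord c p) *v v)"
    by (simp add: sphere_connection_def differential_def DN_eq_shape[OF u] inner_commute)
  then show "differential c x p (A (coord c p) *v v) = - sphere_connection c x \<nu> p v" by simp
  show "w = A (coord c p) *v v" if "differential c x p w = - sphere_connection c x \<nu> p v" for w
    using that inj_DX[OF u] unfolding conn by (simp add: differential_def inj_eq)
qed

lemma trace_shape_operator:
  "p \<in> chart_dom c \<Longrightarrow> trace (matrix (shape_operator c x \<nu> p)) = trace (A (coord c p))"
proof -
  assume "p \<in> chart_dom c"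
  then have "shape_operator c x \<nu> p = (\<lambda>v. A (coord c p) *v v)"
    using shape_operator_eq by blast
  then show ?thesis by (simp add: matrix_of_matrix_vector_mul)
qed

lemma shape_operator_norm_sq:
  assumes p: "p \<in> chart_dom c"
  shows "(\<Sum>i\<in>UNIV. \<Sum>j\<in>UNIV. G (coord c p) $ i $ j *
        (differential c x p (shape_operator c x \<nu> p (axis i 1)) \<bullet> differential c x p (shape_operator c x \<nu> p (axis j 1))))
      = trace (A (coord c p) ** A (coord c p))"
proof -
  note u = codom_point[OF p]
  have "differential c x p (shape_operator c x \<nu> p (axis i 1)) = - dN i (coord c p)" for i
    using DN_eq_shape[OF u, of "axis i 1"]
    by (simp add: shape_operator_eq[OF p] differential_def partial_deriv_def)
  then show ?thesis by (simp add: trace_shape_square[OF u])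
qed

text \<open>The inner product with a fixed \<open>a\<close> passes through both derivatives, and
  \<open>vector_laplacian\<close> uses the index order of the matrix product under the trace, so the
  sums agree term by term.\<close>

lemma chart_laplacian_height:
  assumes y: "smooth_on U (local_expr c y)" and u: "u \<in> U"
  shows "trace (G u ** hessian c x (height y a) u) = vector_laplacian c x (local_expr c y) u \<bullet> a"
proof -
  have h: "local_expr c (height y a) = (\<lambda>w. local_expr c y w \<bullet> a)"
    by (simp add: local_expr_def height_def fun_eq_iff)
  show ?thesis
    unfolding vector_laplacian_inner[OF u]
    by (simp add: trace_def matrix_matrix_mult_def hessian_def h
        partial_deriv2_inner_const[OF y open_codom u]
        partial_deriv_inner_const[OF smooth_on_imp_differentiable[OF y u]])
qed

end

section \<open>Conjugate matrices, locally constant functions, testing on unit vectors\<close>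

lemma trace_similar:
  fixes B C T :: "real ^ 'n::finite ^ 'n"
  assumes "invertible T" "B ** T = T ** C"
  shows "trace B = trace C" "trace (B ** B) = trace (C ** C)"
proof -
  note inv = matrix_inv_works[OF assms(1)]
  have B: "B = T ** (C ** matrix_inv T)"
    using arg_cong[OF assms(2), of "\<lambda>Z. Z ** matrix_inv T"] inv(1)
    by (simp add: matrix_mul_assoc[symmetric])
  have *: "trace (T ** (Z ** matrix_inv T)) = trace Z" for Z :: "real ^ 'n ^ 'n"
    using inv(2) by (subst trace_mul_sym) (simp add: matrix_mul_assoc[symmetric])
  have "B ** B = T ** (C ** (matrix_inv T ** T) ** C ** matrix_inv T)"
    unfolding B by (simp add: matrix_mul_assoc)
  also have "\<dots> = T ** ((C ** C) ** matrix_inv T)"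
    using inv(2) by simp
  finally show "trace (B ** B) = trace (C ** C)" using * by simp
  show "trace B = trace C" unfolding B by (rule *)
qed

lemma locally_constant_imp_constant:
  assumes "connected_space M"
    and loc: "\<And>p. p \<in> topspace M \<Longrightarrow> \<exists>V. openin M V \<and> p \<in> V \<and> (\<forall>q\<in>V. f q = f p)"
  shows "\<exists>h. \<forall>p\<in>topspace M. f p = h"
proof (cases "topspace M = {}")
  case False
  then obtain p0 where p0: "p0 \<in> topspace M" by blast
  let ?T = "\<lambda>P. {q \<in> topspace M. P (f q)}"
  \<comment> \<open>Any condition on the value of \<open>f\<close> cuts out an open set; applied to
    the level set of \<open>f p0\<close> and to its complement, this makes the level set
    clopen.\<close>
  have op: "openin M (?T P)" for P
  proof (subst openin_subopen, intro ballI)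
    fix p assume p: "p \<in> ?T P"
    then have "p \<in> topspace M" by simp
    from loc[OF this] obtain V where V: "openin M V" "p \<in> V" "\<forall>q\<in>V. f q = f p"
      by (elim exE conjE)
    have "V \<subseteq> ?T P"
    proof
      fix q assume q: "q \<in> V"
      have "P (f q)" unfolding bspec[OF V(3) q] using p by simp
      moreover have "q \<in> topspace M" using openin_subset[OF V(1)] q by (rule subsetD)
      ultimately show "q \<in> ?T P" by simp
    qed
    with V(1,2) show "\<exists>V. openin M V \<and> p \<in> V \<and> V \<subseteq> ?T P" by blast
  qed
  let ?S = "{q \<in> topspace M. f q = f p0}"
  have "topspace M - ?S = {q \<in> topspace M. f q \<noteq> f p0}" by blast
  then have "openin M (topspace M - ?S)" using op[of "\<lambda>y. y \<noteq> f p0"] by (rule ssubst)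
  then have "closedin M ?S" by (simp add: closedin_def)
  then have "?S = {} \<or> ?S = topspace M"
    using assms(1) op[of "\<lambda>y. y = f p0"] unfolding connected_space_clopen_in by blast
  then have "\<forall>p\<in>topspace M. f p = f p0" using p0 by blast
  then show ?thesis by (rule exI)
qed auto

text \<open>The basis vectors are unit vectors, so quantifying over the sphere captures a full
  vector equation.\<close>

lemma eq_iff_inner_unit_eq:
  fixes v w :: "'e::euclidean_space"
  shows "v = w \<longleftrightarrow> (\<forall>a\<in>sphere 0 1. v \<bullet> a = w \<bullet> a)"
proof
  assume *: "\<forall>a\<in>sphere 0 1. v \<bullet> a = w \<bullet> a"
  show "v = w"
  proof (rule euclidean_eqI)
    show "v \<bullet> b = w \<bullet> b" if "b \<in> Basis" for b
      by (rule bspec[OF *]) (simp add: that)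
  qed
qed simp

subsection \<open>Independence of the chart\<close>

locale immersed_hypersurface =
  fixes M :: "'m topology" and \<A> :: "('m, 'n::finite) chart set" and x \<nu> :: "'m \<Rightarrow> real ^ 'k::finite"
  assumes dim: "CARD('k) = CARD('n) + 2"
    and manifold: "smooth_manifold M \<A>"
    and immersion: "immersion_into_sphere \<A> x"
    and normal: "unit_normal_field \<A> x \<nu>"
begin

lemma chart: "c \<in> \<A> \<Longrightarrow> is_chart M c"
  using manifold by (simp add: smooth_manifold_def)

lemma hypersurface_chart: "c \<in> \<A> \<Longrightarrow> hypersurface_chart c x \<nu>"
proof -
  assume c: "c \<in> \<A>"
  have ch: "is_chart M c" using chart[OF c] .
  have dom: "topspace (subtopology M (chart_dom c)) = chart_dom c"
    using ch openin_subset[of M "chart_dom c"] by (auto simp: is_chart_def)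
  have inj: "inj_on (coord c) (chart_dom c)"
    using ch dom homeomorphic_imp_injective_map[of "subtopology M (chart_dom c)" _ "coord c"]
    by (auto simp: is_chart_def)
  have le: "local_expr c f (coord c p) = f p" if "p \<in> chart_dom c" for f :: "'m \<Rightarrow> real ^ 'k" and p
    using that inj by (simp add: local_expr_def)
  show ?thesis
  proof
    show "open (chart_codom c)" using ch by (simp add: is_chart_def)
    show "smooth_on (chart_codom c) (local_expr c x)" "smooth_on (chart_codom c) (local_expr c \<nu>)"
      using c immersion normal
      by (simp_all add: immersion_into_sphere_def unit_normal_field_def smooth_map_def)
  next
    fix u assume "u \<in> chart_codom c"
    then obtain p where p: "p \<in> chart_dom c" "u = coord c p" by (auto simp: chart_codom_def)
    have im: "x p \<in> sphere 0 1" "inj (differential c x p)"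
      using c p immersion by (auto simp: immersion_into_sphere_def)
    have no: "norm (\<nu> p) = 1" "\<nu> p \<bullet> x p = 0" "\<And>v. \<nu> p \<bullet> differential c x p v = 0"
      using c p normal by (auto simp: unit_normal_field_def)
    show "local_expr c x u \<bullet> local_expr c x u = 1" "local_expr c \<nu> u \<bullet> local_expr c \<nu> u = 1"
      "local_expr c \<nu> u \<bullet> local_expr c x u = 0"
      using im(1) no(1,2) p by (simp_all add: le dot_square_norm)
    show "local_expr c \<nu> u \<bullet> frechet_derivative (local_expr c x) (at u) v = 0" for v
      using no(3) p by (simp add: le differential_def)
    show "inj (frechet_derivative (local_expr c x) (at u))"
      using im(2) p by (simp add: differential_def)
  qed (fact dim inj)+
qed

lemma chart_at: "p \<in> topspace M \<Longrightarrow> chart_at \<A> p \<in> \<A> \<and> p \<in> chart_dom (chart_at \<A> p)"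
proof -
  assume "p \<in> topspace M"
  then have "\<exists>c. c \<in> \<A> \<and> p \<in> chart_dom c"
    using manifold unfolding smooth_manifold_def by blast
  then show ?thesis unfolding chart_at_def by (rule someI_ex)
qed

lemma chart_dom_subset: "c \<in> \<A> \<Longrightarrow> chart_dom c \<subseteq> topspace M"
  using chart openin_subset unfolding is_chart_def by blast

lemma chart_at_dom:
  assumes "c \<in> \<A>" "p \<in> chart_dom c"
  shows "chart_at \<A> p \<in> \<A>" "p \<in> chart_dom (chart_at \<A> p)"
  using chart_at[OF subsetD[OF chart_dom_subset[OF assms(1)] assms(2)]] by blast+

lemma openin_chart_preimage:
  assumes "c \<in> \<A>" "open B"
  shows "openin M {q \<in> chart_dom c. coord c q \<in> B}"
proof -
  have ch: "is_chart M c" using chart[OF assms(1)] .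
  have cont: "continuous_map (subtopology M (chart_dom c)) (top_of_set (chart_codom c)) (coord c)"
    using ch by (simp add: is_chart_def homeomorphic_imp_continuous_map)
  have "openin (top_of_set (chart_codom c)) (chart_codom c \<inter> B)"
    using assms(2) by (simp add: openin_open_Int)
  from openin_continuous_map_preimage[OF cont this]
  have "openin (subtopology M (chart_dom c)) {q \<in> topspace (subtopology M (chart_dom c)). coord c q \<in> chart_codom c \<inter> B}" .
  moreover have "{q \<in> topspace (subtopology M (chart_dom c)). coord c q \<in> chart_codom c \<inter> B} = {q \<in> chart_dom c. coord c q \<in> B}"
    using chart_dom_subset[OF assms(1)] by (auto simp: chart_codom_def)
  ultimately show ?thesis
    using ch openin_trans_full by (metis is_chart_def)
qed

lemma open_overlap:
  assumes "c \<in> \<A>" "d \<in> \<A>"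
  shows "open (coord c ` (chart_dom c \<inter> chart_dom d))"
proof -
  have ch: "is_chart M c" "is_chart M d" using chart assms by auto
  have "openin (subtopology M (chart_dom c)) (chart_dom c \<inter> chart_dom d)"
    using ch by (metis is_chart_def openin_subtopology_Int2)
  moreover have "open_map (subtopology M (chart_dom c)) (top_of_set (chart_codom c)) (coord c)"
    using ch by (simp add: is_chart_def homeomorphic_imp_open_map)
  ultimately have "openin (top_of_set (chart_codom c)) (coord c ` (chart_dom c \<inter> chart_dom d))"
    by (simp add: open_map_def)
  then show ?thesis using ch openin_open_trans by (metis is_chart_def)
qed

lemma transition:
  assumes "c \<in> \<A>" "d \<in> \<A>" "p \<in> chart_dom c" "p \<in> chart_dom d"
  defines "\<tau> \<equiv> local_expr c (coord d)"
  shows "\<tau> (coord c p) = coord d p"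
proof -
  interpret c: hypersurface_chart c x \<nu> using hypersurface_chart assms by blast
  show ?thesis using assms c.local_expr_coord by simp
qed

lemma transition_differentiable:
  assumes "c \<in> \<A>" "d \<in> \<A>" "p \<in> chart_dom c" "p \<in> chart_dom d"
  shows "local_expr c (coord d) differentiable (at (coord c p))"
proof (rule smooth_on_imp_differentiable)
  show "smooth_on (coord c ` (chart_dom c \<inter> chart_dom d)) (local_expr c (coord d))"
    using manifold assms(1,2) unfolding smooth_manifold_def by blast
  show "coord c p \<in> coord c ` (chart_dom c \<inter> chart_dom d)" using assms(3,4) by blast
qed

text \<open>Chain rule for a change of chart: \<open>f\<close> and \<open>g\<close> express one map
  in the coordinates of \<open>d\<close> and \<open>c\<close>. Agreement on the overlap is enough
  because its image is open.\<close>

lemma has_derivative_transition: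
  fixes f :: "real ^ 'n \<Rightarrow> 'b::euclidean_space"
  assumes "c \<in> \<A>" "d \<in> \<A>" "p \<in> chart_dom c" "p \<in> chart_dom d"
    and f: "(f has_derivative f') (at (coord d p))"
    and eq: "\<And>q. q \<in> chart_dom c \<Longrightarrow> q \<in> chart_dom d \<Longrightarrow> g (coord c q) = f (coord d q)"
  shows "(g has_derivative f' \<circ> frechet_derivative (local_expr c (coord d)) (at (coord c p))) (at (coord c p))"
proof -
  let ?\<tau> = "local_expr c (coord d)"
  have "(f \<circ> ?\<tau> has_derivative f' \<circ> frechet_derivative ?\<tau> (at (coord c p))) (at (coord c p))"
    using f transition[OF assms(1-4)]
    by (intro diff_chain_at frechet_derivative_has_derivative transition_differentiable[OF assms(1-4)]) simp
  then show ?thesis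
  proof (rule has_derivative_transform_within_open[OF _ open_overlap[OF assms(1,2)]])
    show "coord c p \<in> coord c ` (chart_dom c \<inter> chart_dom d)" using assms by blast
    show "(f \<circ> ?\<tau>) w = g w" if "w \<in> coord c ` (chart_dom c \<inter> chart_dom d)" for w
      using that transition[OF assms(1,2)] eq by auto
  qed
qed

text \<open>With \<open>T\<close> the Jacobian of the transition map, the differentials of
  \<open>x\<close> and \<open>\<nu>\<close> in \<open>c\<close> are those in \<open>d\<close>
  composed with \<open>T\<close>. Comparing \<open>DN_eq_shape\<close> in both charts and cancelling
  the injective \<open>d.DX\<close> gives the conjugacy.\<close>

lemma shape_matrix_transition:
  assumes "c \<in> \<A>" "d \<in> \<A>" "p \<in> chart_dom c" "p \<in> chart_dom d"
  obtains T where "invertible T"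
    "shape_matrix d x \<nu> (coord d p) ** T = T ** shape_matrix c x \<nu> (coord c p)"
proof -
  interpret c: hypersurface_chart c x \<nu> using hypersurface_chart assms by blast
  interpret d: hypersurface_chart d x \<nu> using hypersurface_chart assms by blast
  let ?D = "frechet_derivative (local_expr c (coord d)) (at (coord c p))"
  note uc = c.codom_point[OF assms(3)] and ud = d.codom_point[OF assms(4)]
  have lin: "linear ?D" by (rule linear_frechet_derivative[OF transition_differentiable[OF assms]])
  define T where "T = matrix ?D"
  have T: "T *v v = ?D v" for v by (simp add: T_def matrix_works lin)
  have X: "c.DX (coord c p) v = d.DX (coord d p) (T *v v)" for v
    using frechet_derivative_eqI[OF has_derivative_transition[OF assms
          frechet_derivative_has_derivative[OF d.diff_X[OF ud]], of "local_expr c x"]]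
    by (simp add: c.local_expr_coord d.local_expr_coord T)
  have N: "c.DN (coord c p) v = d.DN (coord d p) (T *v v)" for v
    using frechet_derivative_eqI[OF has_derivative_transition[OF assms
          frechet_derivative_has_derivative[OF d.diff_N[OF ud]], of "local_expr c \<nu>"]]
    by (simp add: c.local_expr_coord d.local_expr_coord T)
  \<comment> \<open>A kernel vector of \<open>T\<close> lies in the kernel of the injective
    \<open>c.DX\<close>; a square matrix with trivial kernel is invertible.\<close>
  have "v = 0" if "T *v v = 0" for v
  proof -
    have "c.DX (coord c p) v = c.DX (coord c p) 0" unfolding X that by simp
    then show ?thesis using c.inj_DX[OF uc] by (simp add: inj_eq)
  qed
  then have inv: "invertible T"
    using invertible_left_inverse matrix_left_invertible_ker by blast
  have "d.DX (coord d p) (shape_matrix d x \<nu> (coord d p) *v (T *v v))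
      = d.DX (coord d p) (T *v (shape_matrix c x \<nu> (coord c p) *v v))" for v
    using N[of v] unfolding c.DN_eq_shape[OF uc] d.DN_eq_shape[OF ud] X by simp
  then have "shape_matrix d x \<nu> (coord d p) *v (T *v v) = T *v (shape_matrix c x \<nu> (coord c p) *v v)" for v
    using d.inj_DX[OF ud] by (simp add: inj_eq)
  then have "shape_matrix d x \<nu> (coord d p) ** T = T ** shape_matrix c x \<nu> (coord c p)"
    by (simp add: matrix_eq matrix_vector_mul_assoc)
  with inv show thesis by (rule that)
qed

lemma mean_curvature_eq:
  assumes "c \<in> \<A>" "p \<in> chart_dom c"
  shows "real CARD('n) * mean_curvature \<A> x \<nu> p = trace (shape_matrix c x \<nu> (coord c p))"
proof -
  have d: "chart_at \<A> p \<in> \<A>" "p \<in> chart_dom (chart_at \<A> p)"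
    by (rule chart_at_dom[OF assms])+
  obtain T where "invertible T"
    "shape_matrix (chart_at \<A> p) x \<nu> (coord (chart_at \<A> p) p) ** T = T ** shape_matrix c x \<nu> (coord c p)"
    using shape_matrix_transition[OF assms(1) d(1) assms(2) d(2)] .
  from trace_similar(1)[OF this] show ?thesis
    by (simp add: mean_curvature_def
        hypersurface_chart.trace_shape_operator[OF hypersurface_chart[OF d(1)] d(2)])
qed

lemma second_ff_sq_eq:
  assumes "c \<in> \<A>" "p \<in> chart_dom c"
  shows "second_ff_sq \<A> x \<nu> p = trace (shape_matrix c x \<nu> (coord c p) ** shape_matrix c x \<nu> (coord c p))"
proof -
  have d: "chart_at \<A> p \<in> \<A>" "p \<in> chart_dom (chart_at \<A> p)"
    by (rule chart_at_dom[OF assms])+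
  obtain T where "invertible T"
    "shape_matrix (chart_at \<A> p) x \<nu> (coord (chart_at \<A> p) p) ** T = T ** shape_matrix c x \<nu> (coord c p)"
    using shape_matrix_transition[OF assms(1) d(1) assms(2) d(2)] .
  from trace_similar(2)[OF this] show ?thesis
    by (simp add: second_ff_sq_def Let_def
        hypersurface_chart.shape_operator_norm_sq[OF hypersurface_chart[OF d(1)] d(2)])
qed

text \<open>Since \<open>n H = tr A\<close>, this says that the differential of the mean curvature
  vanishes at \<open>p\<close>. It refers to the one chart \<open>chart_at \<A> p\<close>;
  \<open>critical_point_has_derivative_zero\<close> carries it to every chart around
  \<open>p\<close>.\<close>

definition critical_point :: "'m \<Rightarrow> bool" where
  "critical_point p \<longleftrightarrow> (let c = chart_at \<A> p in
     \<forall>l. partial_deriv l (\<lambda>w. trace (shape_matrix c x \<nu> w)) (coord c p) = 0)"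

section \<open>The height equations at a single point\<close>

lemma laplacian_height:
  assumes p: "p \<in> topspace M" and y: "smooth_map \<A> y"
  shows "laplacian \<A> x (height y a) p =
    vector_laplacian (chart_at \<A> p) x (local_expr (chart_at \<A> p) y) (coord (chart_at \<A> p) p) \<bullet> a"
proof -
  have c: "chart_at \<A> p \<in> \<A>" "p \<in> chart_dom (chart_at \<A> p)" using chart_at[OF p] by auto
  interpret hypersurface_chart "chart_at \<A> p" x \<nu> by (rule hypersurface_chart[OF c(1)])
  have "smooth_on (chart_codom (chart_at \<A> p)) (local_expr (chart_at \<A> p) y)"
    using y c by (simp add: smooth_map_def)
  then show ?thesis
    by (simp add: laplacian_def Let_def chart_laplacian_height codom_point[OF c(2)])
qed

text \<open>For all unit \<open>a\<close> together the equation is one vector equation between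
  combinations of the orthonormal vectors \<open>x p\<close> and \<open>\<nu> p\<close>, so
  coefficients can be compared.\<close>

lemma laplacian_position_height_iff:
  assumes p: "p \<in> topspace M"
  shows "(\<forall>a\<in>sphere 0 1. laplacian \<A> x (height x a) p = - l * height x a p + real CARD('n) * m * height \<nu> a p)
    \<longleftrightarrow> l = real CARD('n) \<and> m = mean_curvature \<A> x \<nu> p"
proof -
  let ?c = "chart_at \<A> p"
  let ?n = "real CARD('n)" and ?H = "mean_curvature \<A> x \<nu> p"
  have c: "?c \<in> \<A>" "p \<in> chart_dom ?c" using chart_at[OF p] by auto
  interpret hypersurface_chart ?c x \<nu> by (rule hypersurface_chart[OF c(1)])
  note u = codom_point[OF c(2)] and le = local_expr_coord[OF c(2)]
  have on: "x p \<bullet> x p = 1" "\<nu> p \<bullet> \<nu> p = 1" "\<nu> p \<bullet> x p = 0" "x p \<bullet> \<nu> p = 0"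
    using X_X[OF u] N_N[OF u] N_X[OF u] by (simp_all add: le inner_commute)
  have "smooth_map \<A> x" using immersion by (simp add: immersion_into_sphere_def)
  note lap = laplacian_height[OF p this]
  have "(\<forall>a\<in>sphere 0 1. laplacian \<A> x (height x a) p = - l * height x a p + ?n * m * height \<nu> a p)
    \<longleftrightarrow> vector_laplacian ?c x X (coord ?c p) = - l *\<^sub>R x p + (?n * m) *\<^sub>R \<nu> p"
    unfolding eq_iff_inner_unit_eq[of "vector_laplacian _ _ _ _"] lap by (simp add: height_def inner_diff_left inner_add_left)
  also have "\<dots> \<longleftrightarrow> - ?n *\<^sub>R x p + (?n * ?H) *\<^sub>R \<nu> p = - l *\<^sub>R x p + (?n * m) *\<^sub>R \<nu> p"
    unfolding laplacian_X_eq[OF u] mean_curvature_eq[OF c] le ..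
  also have "\<dots> \<longleftrightarrow> l = ?n \<and> m = ?H"
  proof
    assume eq: "- ?n *\<^sub>R x p + (?n * ?H) *\<^sub>R \<nu> p = - l *\<^sub>R x p + (?n * m) *\<^sub>R \<nu> p"
    have "?n = l" using arg_cong[OF eq, of "\<lambda>z. z \<bullet> x p"] by (simp add: inner_add_left inner_diff_left on)
    moreover have "?n * ?H = ?n * m"
      using arg_cong[OF eq, of "\<lambda>z. z \<bullet> \<nu> p"] by (simp add: inner_add_left inner_diff_left on)
    then have "?H = m" by simp
    ultimately show "l = ?n \<and> m = ?H" by blast
  qed simp
  finally show ?thesis .
qed

lemma laplacian_normal_height_iff:
  assumes p: "p \<in> topspace M"
  shows "(\<forall>a\<in>sphere 0 1. laplacian \<A> x (height \<nu> a) p = - l * height \<nu> a p + real CARD('n) * m * height x a p)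
    \<longleftrightarrow> l = second_ff_sq \<A> x \<nu> p \<and> m = mean_curvature \<A> x \<nu> p \<and> critical_point p"
proof -
  let ?c = "chart_at \<A> p"
  let ?n = "real CARD('n)"
  have c: "?c \<in> \<A>" "p \<in> chart_dom ?c" using chart_at[OF p] by auto
  interpret hypersurface_chart ?c x \<nu> by (rule hypersurface_chart[OF c(1)])
  note u = codom_point[OF c(2)] and le = local_expr_coord[OF c(2)]
  have "smooth_map \<A> \<nu>" using normal by (simp add: unit_normal_field_def)
  note lap = laplacian_height[OF p this]
  have "(\<forall>a\<in>sphere 0 1. laplacian \<A> x (height \<nu> a) p = - l * height \<nu> a p + ?n * m * height x a p)
    \<longleftrightarrow> vector_laplacian ?c x N (coord ?c p) = - l *\<^sub>R N (coord ?c p) + (?n * m) *\<^sub>R X (coord ?c p)"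
    unfolding eq_iff_inner_unit_eq[of "vector_laplacian _ _ _ _"] lap by (simp add: height_def inner_diff_left inner_add_left le)
  also have "\<dots> \<longleftrightarrow> l = second_ff_sq \<A> x \<nu> p \<and> m = mean_curvature \<A> x \<nu> p \<and> critical_point p"
    unfolding laplacian_N_eq_iff[OF u] second_ff_sq_eq[OF c] mean_curvature_eq[OF c, symmetric]
    by (simp add: critical_point_def Let_def)
  finally show ?thesis .
qed

section \<open>Constancy of the mean curvature and continuity of \<open>S\<close>\<close>

lemma constant_mean_curvature_imp_critical_point:
  assumes H: "\<And>q. q \<in> topspace M \<Longrightarrow> mean_curvature \<A> x \<nu> q = h" and p: "p \<in> topspace M"
  shows "critical_point p"
proof -
  let ?c = "chart_at \<A> p"
  have c: "?c \<in> \<A>" "p \<in> chart_dom ?c" using chart_at[OF p] by auto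
  interpret hypersurface_chart ?c x \<nu> by (rule hypersurface_chart[OF c(1)])
  note u = codom_point[OF c(2)]
  have "trace (A w) = real CARD('n) * h" if "w \<in> U" for w
  proof -
    obtain q where "q \<in> chart_dom ?c" "w = coord ?c q" using \<open>w \<in> U\<close> by (auto simp: chart_codom_def)
    then show ?thesis
      using mean_curvature_eq[OF c(1), of q] H chart_dom_subset[OF c(1)] by auto
  qed
  then have "partial_deriv l (\<lambda>w. trace (A w)) (coord ?c p) = partial_deriv l (\<lambda>_. real CARD('n) * h) (coord ?c p)" for l
    by (intro partial_deriv_cong[OF open_codom u]) (auto intro: differentiable_trace_shape[OF u])
  then show ?thesis by (simp add: critical_point_def Let_def partial_deriv_def)
qed

text \<open>The trace of the shape matrix is the same function in all charts, so its vanishing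
  derivative transfers by the chain rule. This matters because \<open>chart_at\<close> may change
  between nearby points while constancy is shown in one chart.\<close>

lemma critical_point_has_derivative_zero:
  assumes p: "critical_point p" "c \<in> \<A>" "p \<in> chart_dom c"
  shows "((\<lambda>w. trace (shape_matrix c x \<nu> w)) has_derivative (\<lambda>_. 0)) (at (coord c p))"
proof -
  let ?d = "chart_at \<A> p"
  have d: "?d \<in> \<A>" "p \<in> chart_dom ?d" by (rule chart_at_dom[OF p(2,3)])+
  interpret d: hypersurface_chart ?d x \<nu> by (rule hypersurface_chart[OF d(1)])
  note diff = d.differentiable_trace_shape[OF d.codom_point[OF d(2)]]
  have "frechet_derivative (\<lambda>w. trace (d.A w)) (at (coord ?d p)) = (\<lambda>_. 0)"
    using p(1) by (simp add: fun_eq_iff frechet_derivative_eq_sum_partial_deriv[OF diff] critical_point_def Let_def)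
  then have zero: "((\<lambda>w. trace (d.A w)) has_derivative (\<lambda>_. 0)) (at (coord ?d p))"
    using frechet_derivative_has_derivative[OF diff] by simp
  have eq: "trace (shape_matrix c x \<nu> (coord c q)) = trace (d.A (coord ?d q))"
    if "q \<in> chart_dom c" "q \<in> chart_dom ?d" for q
    using mean_curvature_eq[OF p(2) that(1)] mean_curvature_eq[OF d(1) that(2)] by simp
  from has_derivative_transition[OF p(2) d(1) p(3) d(2) zero, of "\<lambda>w. trace (shape_matrix c x \<nu> w)", OF eq]
  show ?thesis by (simp add: o_def)
qed

lemma critical_points_imp_constant_mean_curvature:
  assumes "connected_space M" and crit: "\<And>p. p \<in> topspace M \<Longrightarrow> critical_point p"
  shows "\<exists>h. \<forall>p\<in>topspace M. mean_curvature \<A> x \<nu> p = h"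
proof (rule locally_constant_imp_constant[OF assms(1)])
  fix p assume p: "p \<in> topspace M"
  let ?c = "chart_at \<A> p"
  have c: "?c \<in> \<A>" "p \<in> chart_dom ?c" using chart_at[OF p] by auto
  interpret hypersurface_chart ?c x \<nu> by (rule hypersurface_chart[OF c(1)])
  obtain e where e: "e > 0" "ball (coord ?c p) e \<subseteq> U"
    using open_codom codom_point[OF c(2)] by (auto simp: open_contains_ball)
  \<comment> \<open>The ball is convex, so a vanishing derivative on it gives a constant
    function.\<close>
  have "\<exists>k. \<forall>w\<in>ball (coord ?c p) e. trace (A w) = k"
  proof (rule has_derivative_zero_constant)
    fix w assume "w \<in> ball (coord ?c p) e"
    then obtain q where q: "q \<in> chart_dom ?c" "w = coord ?c q" using e by (auto simp: chart_codom_def)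
    then have "critical_point q" using crit chart_dom_subset[OF c(1)] by auto
    from critical_point_has_derivative_zero[OF this c(1) q(1)]
    show "((\<lambda>w. trace (A w)) has_derivative (\<lambda>_. 0)) (at w within ball (coord ?c p) e)"
      unfolding q(2) by (rule has_derivative_at_withinI)
  qed simp
  then obtain k where k: "\<And>w. w \<in> ball (coord ?c p) e \<Longrightarrow> trace (A w) = k" by blast
  have H: "real CARD('n) * mean_curvature \<A> x \<nu> q = k"
    if "q \<in> chart_dom ?c" "coord ?c q \<in> ball (coord ?c p) e" for q
    using mean_curvature_eq[OF c(1)] k that by simp
  show "\<exists>V. openin M V \<and> p \<in> V \<and> (\<forall>q\<in>V. mean_curvature \<A> x \<nu> q = mean_curvature \<A> x \<nu> p)"
  proof (intro exI conjI)
    show "openin M {q \<in> chart_dom ?c. coord ?c q \<in> ball (coord ?c p) e}"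
      by (rule openin_chart_preimage[OF c(1) open_ball])
    show "p \<in> {q \<in> chart_dom ?c. coord ?c q \<in> ball (coord ?c p) e}" using c(2) e(1) by simp
    have "real CARD('n) * mean_curvature \<A> x \<nu> q = real CARD('n) * mean_curvature \<A> x \<nu> p"
      if "q \<in> chart_dom ?c" "coord ?c q \<in> ball (coord ?c p) e" for q
      using H[OF that] H[OF c(2)] e(1) by simp
    then show "\<forall>q\<in>{q \<in> chart_dom ?c. coord ?c q \<in> ball (coord ?c p) e}.
        mean_curvature \<A> x \<nu> q = mean_curvature \<A> x \<nu> p" by simp
  qed
qed

text \<open>The definition picks a chart at each point separately, so continuity is shown locally in
  one fixed chart, where \<open>second_ff_sq_eq\<close> identifies \<open>S\<close> with the
  continuous function \<open>tr A\<^sup>2\<close>.\<close>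

lemma continuous_second_ff_sq: "continuous_map M euclideanreal (second_ff_sq \<A> x \<nu>)"
  unfolding continuous_map_def
proof (intro conjI allI impI)
  fix B :: "real set" assume "openin euclideanreal B"
  then have B: "open B" by simp
  show "openin M {p \<in> topspace M. second_ff_sq \<A> x \<nu> p \<in> B}"
  proof (subst openin_subopen, intro ballI)
    fix p assume p: "p \<in> {p \<in> topspace M. second_ff_sq \<A> x \<nu> p \<in> B}"
    let ?c = "chart_at \<A> p"
    have c: "?c \<in> \<A>" "p \<in> chart_dom ?c" using chart_at p by auto
    interpret hypersurface_chart ?c x \<nu> by (rule hypersurface_chart[OF c(1)])
    have "(\<lambda>w. trace (A w ** A w)) differentiable (at u)" if "u \<in> U" for u
      unfolding trace_def matrix_matrix_mult_def
      using that by (auto intro!: differentiable_sum differentiable_mult differentiable_shape)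
    then have "continuous_on U (\<lambda>w. trace (A w ** A w))"
      by (intro continuous_at_imp_continuous_on ballI differentiable_imp_continuous_within)
    then have op: "open (U \<inter> (\<lambda>w. trace (A w ** A w)) -` B)"
      using open_codom B by (rule continuous_open_preimage)
    let ?V = "{q \<in> chart_dom ?c. coord ?c q \<in> U \<inter> (\<lambda>w. trace (A w ** A w)) -` B}"
    have "openin M ?V" by (rule openin_chart_preimage[OF c(1) op])
    moreover have "q \<in> ?V \<longleftrightarrow> second_ff_sq \<A> x \<nu> q \<in> B" if "q \<in> chart_dom ?c" for q
      using that by (simp add: second_ff_sq_eq[OF c(1)] codom_point)
    ultimately show "\<exists>V. openin M V \<and> p \<in> V \<and> V \<subseteq> {p \<in> topspace M. second_ff_sq \<A> x \<nu> p \<in> B}"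
      using p c chart_dom_subset[OF c(1)] by (intro exI[of _ ?V]) blast
  qed
qed simp

end

theorem theorem2p1:
  fixes M :: "'m topology"
    and \<A> :: "('m, 'n::finite) chart set"
    and x \<nu> :: "'m \<Rightarrow> real ^ 'k"
    and n :: real and H S :: "'m \<Rightarrow> real"
  defines "n \<equiv> real CARD('n)"
    and "H \<equiv> mean_curvature \<A> x \<nu>"
    and "S \<equiv> second_ff_sq \<A> x \<nu>"
  assumes dim: "CARD('k) = CARD('n) + 2"
    and manifold: "smooth_manifold M \<A>"
    and connected: "connected_space M"
    and immersion: "immersion_into_sphere \<A> x"
    and normal: "unit_normal_field \<A> x \<nu>"
  shows
    "(((\<exists>h. \<forall>p\<in>topspace M. H p = h) \<longleftrightarrow>
         (\<exists>lam \<mu>. continuous_map M euclideanreal lam \<and>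
            (\<forall>a\<in>sphere 0 1. \<forall>p\<in>topspace M.
               laplacian \<A> x (height x a) p = - lam p * height x a p + n * \<mu> * height \<nu> a p))) \<and>
      (\<forall>lam \<mu>. continuous_map M euclideanreal lam \<and>
            (\<forall>a\<in>sphere 0 1. \<forall>p\<in>topspace M.
               laplacian \<A> x (height x a) p = - lam p * height x a p + n * \<mu> * height \<nu> a p)
         \<longrightarrow> (\<forall>p\<in>topspace M. lam p = n \<and> \<mu> = H p)) \<and>
      ((\<forall>p\<in>topspace M. H p = 0) \<longleftrightarrow>
         (\<exists>lam. continuous_map M euclideanreal lam \<and>
            (\<forall>a\<in>sphere 0 1. \<forall>p\<in>topspace M.
               laplacian \<A> x (height x a) p = - lam p * height x a p)))) \<and>

     (((\<exists>h. \<forall>p\<in>topspace M. H p = h) \<longleftrightarrow>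
         (\<exists>lam \<mu>. continuous_map M euclideanreal lam \<and> continuous_map M euclideanreal \<mu> \<and>
            (\<forall>a\<in>sphere 0 1. \<forall>p\<in>topspace M.
               laplacian \<A> x (height \<nu> a) p = - lam p * height \<nu> a p + n * \<mu> p * height x a p))) \<and>
      (\<forall>lam \<mu>. continuous_map M euclideanreal lam \<and> continuous_map M euclideanreal \<mu> \<and>
            (\<forall>a\<in>sphere 0 1. \<forall>p\<in>topspace M.
               laplacian \<A> x (height \<nu> a) p = - lam p * height \<nu> a p + n * \<mu> p * height x a p)
         \<longrightarrow> (\<forall>p\<in>topspace M. lam p = S p \<and> \<mu> p = H p)) \<and>
      ((\<forall>p\<in>topspace M. H p = 0) \<longleftrightarrow>
         (\<exists>lam. continuous_map M euclideanreal lam \<and>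
            (\<forall>a\<in>sphere 0 1. \<forall>p\<in>topspace M.
               laplacian \<A> x (height \<nu> a) p = - lam p * height \<nu> a p)))) \<and>

     (((\<exists>h s. \<forall>p\<in>topspace M. H p = h \<and> S p = s) \<longleftrightarrow>
         (\<exists>lam \<mu>. continuous_map M euclideanreal \<mu> \<and>
            (\<forall>a\<in>sphere 0 1. \<forall>p\<in>topspace M.
               laplacian \<A> x (height \<nu> a) p = - lam * height \<nu> a p + n * \<mu> p * height x a p))) \<and>
      (\<forall>lam \<mu>. continuous_map M euclideanreal \<mu> \<and>
            (\<forall>a\<in>sphere 0 1. \<forall>p\<in>topspace M.
               laplacian \<A> x (height \<nu> a) p = - lam * height \<nu> a p + n * \<mu> p * height x a p)
         \<longrightarrow> (\<forall>p\<in>topspace M. lam = S p \<and> \<mu> p = H p)) \<and>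
      (((\<forall>p\<in>topspace M. H p = 0) \<and> (\<exists>s. \<forall>p\<in>topspace M. S p = s)) \<longleftrightarrow>
         (\<exists>lam. \<forall>a\<in>sphere 0 1. \<forall>p\<in>topspace M.
               laplacian \<A> x (height \<nu> a) p = - lam * height \<nu> a p)))"
proof -
  interpret immersed_hypersurface M \<A> x \<nu>
    using dim manifold immersion normal by unfold_locales
  have H_const_iff: "(\<exists>h. \<forall>p\<in>topspace M. H p = h) \<longleftrightarrow> (\<forall>p\<in>topspace M. critical_point p)"
    unfolding H_def
    using constant_mean_curvature_imp_critical_point
      critical_points_imp_constant_mean_curvature[OF connected] by blast
  have S_cont: "continuous_map M euclideanreal S"
    unfolding S_def by (rule continuous_second_ff_sq)
  \<comment> \<open>In the normal height equations the coefficient \<open>\<mu>\<close> is witnessed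
    by \<open>H\<close>, whose continuity is taken from its constancy.\<close>
  have H_cont: "continuous_map M euclideanreal H" if "\<forall>p\<in>topspace M. H p = h" for h
    using that continuous_map_eq[of M euclideanreal "\<lambda>_. h" H] by simp
  \<comment> \<open>Exchanging the quantifiers over \<open>a\<close> and \<open>p\<close> reduces to
    the pointwise lemma. As \<open>l\<close> and \<open>m\<close> are functions, matching also
    covers constant coefficients.\<close>
  have position_iff: "(\<forall>a\<in>sphere 0 1. \<forall>p\<in>topspace M.
        laplacian \<A> x (height x a) p = - l p * height x a p + n * m p * height \<nu> a p)
      \<longleftrightarrow> (\<forall>p\<in>topspace M. l p = n \<and> m p = H p)" for l m
    using laplacian_position_height_iff unfolding n_def H_def by (simp only: Ball_def) blast
  \<comment> \<open>The minimal case is the general equation with second coefficient zero, which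
    then has to equal \<open>H\<close>.\<close>
  have position_minimal_iff: "(\<forall>a\<in>sphere 0 1. \<forall>p\<in>topspace M.
        laplacian \<A> x (height x a) p = - l p * height x a p)
      \<longleftrightarrow> (\<forall>p\<in>topspace M. l p = n \<and> 0 = H p)" for l
    using position_iff[of l "\<lambda>_. 0"] by simp
  have normal_iff: "(\<forall>a\<in>sphere 0 1. \<forall>p\<in>topspace M.
        laplacian \<A> x (height \<nu> a) p = - l p * height \<nu> a p + n * m p * height x a p)
      \<longleftrightarrow> (\<forall>p\<in>topspace M. l p = S p \<and> m p = H p \<and> critical_point p)" for l m
    using laplacian_normal_height_iff unfolding n_def H_def S_def by (simp only: Ball_def) blast
  have normal_minimal_iff: "(\<forall>a\<in>sphere 0 1. \<forall>p\<in>topspace M.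
        laplacian \<A> x (height \<nu> a) p = - l p * height \<nu> a p)
      \<longleftrightarrow> (\<forall>p\<in>topspace M. l p = S p \<and> 0 = H p \<and> critical_point p)" for l
    using normal_iff[of l "\<lambda>_. 0"] by simp
  have crit: "\<forall>p\<in>topspace M. critical_point p" if "\<forall>p\<in>topspace M. H p = h" for h
    using that H_const_iff by blast
  show ?thesis
    unfolding position_iff position_minimal_iff normal_iff normal_minimal_iff
  proof (intro conjI)
    \<comment> \<open>The witness for \<open>lam\<close> is the constant function \<open>n\<close>,
      and \<open>\<mu>\<close> is the constant value of \<open>H\<close>.\<close>
    show "(\<exists>h. \<forall>p\<in>topspace M. H p = h) \<longleftrightarrow>
        (\<exists>lam \<mu>. continuous_map M euclideanreal lam \<and> (\<forall>p\<in>topspace M. lam p = n \<and> \<mu> = H p))"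
      using continuous_map_const[of M euclideanreal n] by (metis UNIV_I topspace_euclidean)
    show "(\<forall>p\<in>topspace M. H p = 0) \<longleftrightarrow>
        (\<exists>lam. continuous_map M euclideanreal lam \<and> (\<forall>p\<in>topspace M. lam p = n \<and> 0 = H p))"
      using continuous_map_const[of M euclideanreal n] by (metis UNIV_I topspace_euclidean)
    show "(\<exists>h. \<forall>p\<in>topspace M. H p = h) \<longleftrightarrow>
        (\<exists>lam \<mu>. continuous_map M euclideanreal lam \<and> continuous_map M euclideanreal \<mu> \<and>
          (\<forall>p\<in>topspace M. lam p = S p \<and> \<mu> p = H p \<and> critical_point p))"
      using H_const_iff H_cont S_cont by metis
    show "(\<forall>p\<in>topspace M. H p = 0) \<longleftrightarrow>
        (\<exists>lam. continuous_map M euclideanreal lam \<and>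
          (\<forall>p\<in>topspace M. lam p = S p \<and> 0 = H p \<and> critical_point p))"
      using crit[of 0] S_cont by metis
    \<comment> \<open>A number \<open>lam\<close> equal to \<open>S\<close> everywhere already makes
      \<open>S\<close> constant; \<open>H\<close> is constant because every point is
      critical.\<close>
    show "(\<exists>h s. \<forall>p\<in>topspace M. H p = h \<and> S p = s) \<longleftrightarrow>
        (\<exists>lam \<mu>. continuous_map M euclideanreal \<mu> \<and>
          (\<forall>p\<in>topspace M. lam = S p \<and> \<mu> p = H p \<and> critical_point p))"
      using H_const_iff H_cont by metis
    show "(\<forall>p\<in>topspace M. H p = 0) \<and> (\<exists>s. \<forall>p\<in>topspace M. S p = s) \<longleftrightarrow>
        (\<exists>lam. \<forall>p\<in>topspace M. lam = S p \<and> 0 = H p \<and> critical_point p)"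
      using crit[of 0] by metis
  qed simp_all
qed

end
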